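(* For an arbitrary Legendrian knot $K$ in $\mathcal{H}\cup\{\infty\}$ and any Möbius transformation $T\in\mathrm{PU}(2,1)$, $E(K)=E(T(K))$ holds.
   Context: $\mathcal{H}=\mathbb{C}\times\mathbb{R}$ is the 3-dimensional Heisenberg group with coordinates $(z,u)=(x,y,u)$, group law $(z,u)\cdot(z',u')=(z+z',u+u'-\tfrac{1}{2}\Im(z\overline{z'}))$, horizontal distribution spanned by $X=\partial_x-\tfrac12 y\,\partial_u$, $Y=\partial_y+\tfrac12 x\,\partial_u$ (orthonormal, norm $|\cdot|$). The Korányi distance is $d_{\mathcal{H}}(p,q)=\|p^{-1}q\|_{\mathcal{H}}$, $\|(x,y,u)\|_{\mathcal{H}}=\sqrt[4]{(x^2+y^2)^2+16u^2}$, with balls $\mathbb{B}_{\mathcal{H}}(p;\varepsilon)$. Legendrian knots in $\mathcal{H}\cup\{\infty\}\cong S^3$ are smooth embedded closed Legendrian curves, possibly passing through $\infty$ (then called open/infinite). For such $K$ with arc-length measure, $V(K;p)=\lim_{\varepsilon\to+0}\bigl(\int_{K\setminus\mathbb{B}_{\mathcal{H}}(p;\varepsilon)}\frac{dq}{d_{\mathcal{H}}(p,q)^2}-\frac{2}{\varepsilon}\bigr)$ and $E(K)=\int_K V(K;p)\,dp$ (for finite $K$ this equals $B_K(-2)$, the value at $-2$ of the meromorphic continuation of $\zeta\mapsto\iint_{K\times K}d_{\mathcal{H}}(p,q)^\zeta\,dp\,dq$). $\mathrm{PU}(2,1)$ is the group of CR automorphisms of $\mathcal{H}\cup\{\infty\}$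 (Möbius transformations), generated by dilations $(x,y,u)\mapsto(\lambda x,\lambda y,\lambda^2u)$, left translations, rotations $(z,u)\mapsto(e^{i\theta}z,u)$, and the inversion $\iota(z,u)=\bigl(z/(|z|^2+4iu),\,-u/(|z|^4+16u^2)\bigr)$. *)

theory Defs
  imports "HOL-Analysis.Analysis"
begin

text \<open>Points of the Heisenberg group H = C x R, coordinates (z,u).
  The one-point compactification H \<union> {\<infinity>} is modelled by the option type,
  with None playing the role of the point at infinity.\<close>

type_synonym hpt = "complex \<times> real"

definition hmult :: "hpt \<Rightarrow> hpt \<Rightarrow> hpt" where
  "hmult p q = (fst p + fst q, snd p + snd q - Im (fst p * cnj (fst q)) / 2)"

definition hinv :: "hpt \<Rightarrow> hpt" where
  "hinv p = (- fst p, - snd p)"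

definition koranyi_norm :: "hpt \<Rightarrow> real" where
  "koranyi_norm p = ((cmod (fst p))\<^sup>2 ^ 2 + 16 * (snd p)\<^sup>2) powr (1/4)"

definition koranyi_dist :: "hpt \<Rightarrow> hpt \<Rightarrow> real" where
  "koranyi_dist p q = koranyi_norm (hmult (hinv p) q)"

text \<open>Generators of PU(2,1), acting on H \<union> {\<infinity>}.\<close>

definition dilation :: "real \<Rightarrow> hpt \<Rightarrow> hpt" where
  "dilation l p = (complex_of_real l * fst p, l\<^sup>2 * snd p)"

definition rotation :: "real \<Rightarrow> hpt \<Rightarrow> hpt" where
  "rotation \<theta> p = (cis \<theta> * fst p, snd p)"

definition inversion :: "hpt \<Rightarrow> hpt" where
  "inversion p = (fst p / (complex_of_real ((cmod (fst p))\<^sup>2) + 4 * \<i> * complex_of_real (snd p)),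
                  - snd p / ((cmod (fst p)) ^ 4 + 16 * (snd p)\<^sup>2))"

definition inversion_ext :: "hpt option \<Rightarrow> hpt option" where
  "inversion_ext P = (case P of None \<Rightarrow> Some (0, 0)
                      | Some p \<Rightarrow> (if p = (0, 0) then None else Some (inversion p)))"

inductive_set mobius :: "(hpt option \<Rightarrow> hpt option) set" where
  dil: "l > 0 \<Longrightarrow> map_option (dilation l) \<in> mobius"
| ltrans: "map_option (hmult a) \<in> mobius"
| rot: "map_option (rotation \<theta>) \<in> mobius"
| inv: "inversion_ext \<in> mobius"
| comp: "S \<in> mobius \<Longrightarrow> T \<in> mobius \<Longrightarrow> S \<circ> T \<in> mobius"

definition smooth_on :: "real set \<Rightarrow> (real \<Rightarrow> 'a::real_normed_vector) \<Rightarrow> bool" where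
  "smooth_on S f \<longleftrightarrow> (\<exists>D :: nat \<Rightarrow> real \<Rightarrow> 'a. D 0 = f \<and>
      (\<forall>n. \<forall>t\<in>S. (D n has_vector_derivative D (Suc n) t) (at t)))"

text \<open>A smooth curve c = (z,u) in H is regular Legendrian at s if c'(s) \<noteq> 0 and
  u' = (x y' - y x')/2 = Im(conj z * z')/2, i.e. the tangent lies in span{X,Y}.\<close>

definition regular_legendrian_at :: "(real \<Rightarrow> hpt) \<Rightarrow> real \<Rightarrow> bool" where
  "regular_legendrian_at c s \<longleftrightarrow>
     vector_derivative c (at s) \<noteq> 0 \<and>
     snd (vector_derivative c (at s)) = Im (cnj (fst (c s)) * fst (vector_derivative c (at s))) / 2"

text \<open>A (parametrised) Legendrian knot in H \<union> {\<infinity>}: a 1-periodic map, injective on one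
  period, which near every parameter is a smooth regular Legendrian curve, either in the
  standard chart of H or in the chart at \<infinity> given by the inversion.\<close>

definition legendrian_knot :: "(real \<Rightarrow> hpt option) \<Rightarrow> bool" where
  "legendrian_knot \<gamma> \<longleftrightarrow>
     (\<forall>t. \<gamma> (t + 1) = \<gamma> t) \<and> inj_on \<gamma> {0..<1} \<and>
     (\<forall>t. \<exists>e>0. \<exists>c :: real \<Rightarrow> hpt. smooth_on (ball t e) c \<and>
          (\<forall>s\<in>ball t e. regular_legendrian_at c s) \<and>
          ((\<forall>s\<in>ball t e. \<gamma> s = Some (c s)) \<or>
           (\<forall>s\<in>ball t e. \<gamma> s = inversion_ext (Some (c s)))))"

text \<open>Sub-Riemannian speed |z'(t)| at a finite point (arc-length density).\<close>

definition hspeed :: "(real \<Rightarrow> hpt option) \<Rightarrow> real \<Rightarrow> real" where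
  "hspeed \<gamma> t = norm (vector_derivative (\<lambda>s. fst (the (\<gamma> s))) (at t))"

definition arc_integral :: "(real \<Rightarrow> hpt option) \<Rightarrow> hpt set \<Rightarrow> (hpt \<Rightarrow> real) \<Rightarrow> real" where
  "arc_integral \<gamma> A f = (LINT t:{0..<1}|lborel.
      (case \<gamma> t of None \<Rightarrow> 0 | Some q \<Rightarrow> (if q \<in> A then f q * hspeed \<gamma> t else 0)))"

definition Vpot :: "(real \<Rightarrow> hpt option) \<Rightarrow> hpt \<Rightarrow> real" where
  "Vpot \<gamma> p = Lim (at_right 0) (\<lambda>\<epsilon>.
      arc_integral \<gamma> {q. koranyi_dist p q \<ge> \<epsilon>} (\<lambda>q. 1 / (koranyi_dist p q)\<^sup>2) - 2 / \<epsilon>)"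

definition energy :: "(real \<Rightarrow> hpt option) \<Rightarrow> real" where
  "energy \<gamma> = arc_integral \<gamma> UNIV (Vpot \<gamma>)"

end

theory Submission
  imports Defs
begin

text \<open>Points of the compactified Heisenberg group are null lines of a Hermitian form on
  \<open>\<complex>\<^sup>3\<close>, with \<open>(z, u)\<close> represented by \<open>(1, z, |z|\<^sup>2 + 4\<i>u)\<close>, and every Moebius transformation is induced by a
  linear isometry \<open>A\<close> of the form. In terms of representatives \<open>v\<close>, \<open>w\<close> the squared Koranyi distance is
  \<open>|\<langle>v, w\<rangle>| / (|v\<^sub>1| |w\<^sub>1|)\<close>, and the horizontal speed of a Legendrian curve is an isometry-invariant quantity
  divided by \<open>|v\<^sub>1|\<close>. Hence \<open>T\<close> multiplies the kernel \<open>dq / d(p, q)\<^sup>2\<close> by a constant depending only on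
  \<open>p\<close>, and \<open>dp\<close> by its inverse; but it changes the truncation \<open>d(p, q) \<ge> \<epsilon>\<close> into a condition whose
  dependence on \<open>q\<close> is non-constant to first order near \<open>p\<close>. Along a Legendrian curve the kernel is
  \<open>1 / (c (s - t)\<^sup>2) + O(1)\<close> without a \<open>1 / (s - t)\<close> term, so the first-order distortions of the two ends of the
  truncated interval cancel in the limit. Thus \<open>V(K; p) dp\<close> is invariant pointwise, wherever both \<open>p\<close> and
  \<open>T p\<close> are finite, which excludes at most two parameters.\<close>

section \<open>Renormalized integrals with a double pole\<close>

text \<open>The two potentials are not compared with each other but with a third quantity:
  \<open>renormalized_potential\<close>, a finite part of the kernel in the parameter of \<gamma>,
  contains neither \<open>T\<close> nor \<epsilon>. One limit statement, valid for every truncation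
  function that behaves like \<open>v * |s - t|\<close> near \<open>t\<close> with a second-order
  correction, then serves \<open>T\<close> and the identity alike. For the leading coefficient to be
  the same \<open>v\<close> as in the pole, the distance in the image is multiplied by a constant
  and \<epsilon> is rescaled with it. The image curve is never given charts of its own: its speed
  and distances are read off \<open>A (v s)\<close>, where \<open>v\<close> lifts \<gamma>, also
  around infinity. The missing \<open>1 / (s - t)\<close> term comes from the Legendrian condition:
  for \<open>z\<close> the horizontal coordinate, the derivative in \<open>s\<close> of the pairing
  of \<open>v t\<close> with \<open>v s\<close> is \<open>2 cnj (z s - z t) z' s\<close>.
  Integrating, its modulus is \<open>m^2 x^2 + r x^3 + O(x^4)\<close> with \<open>x = s - t\<close>,
  \<open>m = |z'|\<close>, \<open>r = Re (cnj z' z'')\<close> at \<open>t\<close>, while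
  \<open>|z' s| = m + (r / m) x + O(x^2)\<close>; the first-order corrections cancel in the
  quotient.\<close>

lemma has_bochner_integral_inverse_square:
  fixes v y B :: real
  assumes "0 < v" "0 < y" "y \<le> B"
  shows "has_bochner_integral lborel (\<lambda>x. 1 / (v * x\<^sup>2) * indicator {y..B} x) (1 / (v * y) - 1 / (v * B))"
proof -
  have "has_bochner_integral lborel (\<lambda>x. 1 / (v * x\<^sup>2) * indicator {y..B} x)
      ((\<lambda>x. - 1 / (v * x)) B - (\<lambda>x. - 1 / (v * x)) y)"
  proof (rule has_bochner_integral_FTC_Icc_real)
    fix x assume "y \<le> x" "x \<le> B"
    then have "x > 0" using assms by simp
    then show "((\<lambda>x. - 1 / (v * x)) has_real_derivative 1 / (v * x\<^sup>2)) (at x)"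
      using assms by (auto intro!: derivative_eq_intros simp: field_simps power2_eq_square)
    show "isCont (\<lambda>x. 1 / (v * x\<^sup>2)) x" using \<open>x > 0\<close> assms by (auto intro!: continuous_intros)
  qed (use assms in auto)
  then show ?thesis by simp
qed

text \<open>The integral over \<open>[y, B]\<close> is \<open>1 / (v * y) - 1 / (v * B)\<close>,
  hence linear in \<open>1 / (v * y)\<close>; this is why \<open>h\<close> is expanded through its
  reciprocal. The condition \<open>h x \<ge> \<epsilon>\<close> reads
  \<open>1 / (v * x) \<le> 1 / \<epsilon> + a + O(x)\<close>, so the cut-off contributes
  \<open>1 / \<epsilon> + a\<close> up to \<open>O(\<epsilon>)\<close>. The bound
  \<open>lower\<close> confines small values of \<open>h\<close> to small \<open>x\<close>, where
  the expansion applies.\<close>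

lemma integral_inverse_square_superlevel:
  fixes h :: "real \<Rightarrow> real"
  assumes v: "0 < v" and B: "0 < B" and c: "0 < c" and \<delta>: "0 < \<delta>" and K: "0 \<le> K"
    and meas: "\<And>\<epsilon>. {x \<in> {0<..<B}. h x \<ge> \<epsilon>} \<in> sets borel"
    and lower: "\<And>x. 0 < x \<Longrightarrow> x < B \<Longrightarrow> h x \<ge> c * x"
    and expand: "\<And>x. 0 < x \<Longrightarrow> x < \<delta> \<Longrightarrow> \<bar>1 / h x - 1 / (v * x) + a\<bar> \<le> K * x"
  shows "((\<lambda>\<epsilon>. (\<integral>x. 1 / (v * x\<^sup>2) * indicator {x \<in> {0<..<B}. h x \<ge> \<epsilon>} x \<partial>lborel) - 1 / \<epsilon>)
           \<longlongrightarrow> a - 1 / (v * B)) (at_right 0)"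
    and "\<And>\<epsilon>. 0 < \<epsilon> \<Longrightarrow> integrable lborel (\<lambda>x. 1 / (v * x\<^sup>2) * indicator {x \<in> {0<..<B}. h x \<ge> \<epsilon>} x)"
proof -
  define S where "S = (\<lambda>\<epsilon>. {x \<in> {0<..<B}. h x \<ge> \<epsilon>})"
  have S_sets[measurable]: "S \<epsilon> \<in> sets borel" for \<epsilon> using meas by (simp add: S_def)
  have int_sub: "integrable lborel (\<lambda>x. 1 / (v * x\<^sup>2) * indicator (S \<epsilon>) x)"
      "(\<integral>x. 1 / (v * x\<^sup>2) * indicator (S \<epsilon>) x \<partial>lborel) \<le> 1 / (v * y) - 1 / (v * B)"
    if "0 < y" "y \<le> B" "S \<epsilon> \<subseteq> {y..B}" for y \<epsilon>
  proof -
    note I = has_bochner_integral_inverse_square[OF v that(1,2)]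
    have le: "1 / (v * x\<^sup>2) * indicator (S \<epsilon>) x \<le> 1 / (v * x\<^sup>2) * indicator {y..B} x" for x
      using that(3) v by (auto simp: indicator_def)
    have nn: "0 \<le> 1 / (v * x\<^sup>2) * indicator (S \<epsilon>) x" for x
      using v by (auto simp: indicator_def)
    show 1: "integrable lborel (\<lambda>x. 1 / (v * x\<^sup>2) * indicator (S \<epsilon>) x)"
      by (rule Bochner_Integration.integrable_bound[OF integrable.intros[OF I]])
        (use le v in \<open>auto intro!: AE_I2 simp: abs_of_nonneg\<close>)
    show "(\<integral>x. 1 / (v * x\<^sup>2) * indicator (S \<epsilon>) x \<partial>lborel) \<le> 1 / (v * y) - 1 / (v * B)"
      using integral_mono[OF 1 integrable.intros[OF I] le] has_bochner_integral_integral_eq[OF I]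
      by simp
  qed
  show "integrable lborel (\<lambda>x. 1 / (v * x\<^sup>2) * indicator {x \<in> {0<..<B}. h x \<ge> \<epsilon>} x)" if "0 < \<epsilon>" for \<epsilon>
  proof -
    \<comment> \<open>\<open>Y\<close> bounds \<open>1 / (v * x)\<close> for the points of
      \<open>S \<epsilon>\<close> in the range of the expansion; the remaining points satisfy
      \<open>x \<ge> \<delta>\<close>.\<close>
    define Y where "Y = 1 / \<epsilon> + \<bar>a\<bar> + K * \<delta>"
    have "Y > 0" using that K \<delta> by (auto simp: Y_def intro!: add_pos_nonneg)
    define y where "y = min B (min \<delta> (1 / (v * Y)))"
    have "S \<epsilon> \<subseteq> {y..B}"
    proof
      fix x assume x: "x \<in> S \<epsilon>"
      have "x \<ge> 1 / (v * Y)" if "x < \<delta>"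
      proof -
        have "1 / h x \<le> 1 / \<epsilon>" using x \<open>0 < \<epsilon>\<close> by (auto simp: S_def frac_le)
        moreover have "\<bar>1 / h x - 1 / (v * x) + a\<bar> \<le> K * x" using expand x that by (auto simp: S_def)
        moreover have "K * x \<le> K * \<delta>" using that K by (simp add: mult_left_mono)
        ultimately have "1 / (v * x) \<le> Y" unfolding Y_def by linarith
        then show ?thesis using x v \<open>Y > 0\<close> by (auto simp: S_def field_simps)
      qed
      then show "x \<in> {y..B}" using x by (cases "x < \<delta>") (auto simp: S_def y_def min_le_iff_disj)
    qed
    then show ?thesis using int_sub(1)[of y \<epsilon>] B \<delta> v \<open>Y > 0\<close> by (auto simp: y_def S_def)
  qed
  then have integ: "integrable lborel (\<lambda>x. 1 / (v * x\<^sup>2) * indicator (S \<epsilon>) x)" if "0 < \<epsilon>" for \<epsilon>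
    using that by (simp add: S_def)
  define J where "J = (\<lambda>\<epsilon>. \<integral>x. 1 / (v * x\<^sup>2) * indicator (S \<epsilon>) x \<partial>lborel)"
  \<comment> \<open>The two summands control the remainder \<open>K * x\<close> in the two
    inclusions below: \<open>x < \<epsilon> / c\<close> for points outside the superlevel set, and
    \<open>x < 2 / v * \<epsilon>\<close> for points inside it that are close to 0.\<close>
  define C where "C = K / c + K * (2 / v)"
  have C: "C \<ge> 0" using K c v by (simp add: C_def)
  have small: "\<forall>\<^sub>F \<epsilon> in at_right 0. M < 1 / \<epsilon>" for M :: real
    using filterlim_inverse_at_top_right by (auto simp: filterlim_at_top_dense inverse_eq_divide)
  have lt: "\<forall>\<^sub>F \<epsilon> in at_right 0. \<epsilon> < r" if "r > 0" for r :: real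
    using that by (auto simp: eventually_at_right)
  have bounds: "\<forall>\<^sub>F \<epsilon> in at_right 0. \<bar>J \<epsilon> - 1 / \<epsilon> - (a - 1 / (v * B))\<bar> \<le> C * \<epsilon>"
    \<comment> \<open>The first condition puts both cut-offs \<open>1 / (v * Yp)\<close> and
      \<open>1 / (v * Ym)\<close> below \<open>B\<close>; the conditions on \<epsilon> against
      \<delta> give \<open>\<epsilon> / c < \<delta>\<close> and
      \<open>2 / v * \<epsilon> < \<delta>\<close>, so that the expansion is available.\<close>
    using small[of "2 * \<bar>a\<bar> + 2 * C + 1 / (v * B) + 1"] lt[OF zero_less_one]
      lt[OF mult_pos_pos[OF \<delta> c]] lt[OF half_gt_zero[OF mult_pos_pos[OF \<delta> v]]]
      eventually_at_right_less[of "0::real"]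
  proof eventually_elim
    case (elim \<epsilon>)
    have Ce: "C * \<epsilon> \<le> C" "0 \<le> C * \<epsilon>" using elim C by (auto simp: mult_left_le)
    have CK: "K * (2 / v * \<epsilon>) \<le> C * \<epsilon>" "K * (\<epsilon> / c) \<le> C * \<epsilon>"
      using elim K c v by (auto simp: C_def algebra_simps)
    have vB: "1 / (v * B) > 0" using v B by simp
    define N where "N = 1 / \<epsilon>"
    define Yp Ym where "Yp = 1 / \<epsilon> + a + C * \<epsilon>" and "Ym = 1 / \<epsilon> + a - C * \<epsilon>"
    have Y: "Yp > 1 / (v * B)" "Ym > 1 / (v * B)" using elim Ce vB unfolding Yp_def Ym_def by linarith+
    have yB: "0 < 1 / (v * Y)" "1 / (v * Y) \<le> B" "1 / (v * (1 / (v * Y))) = Y" if "Y > 1 / (v * B)" for Y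
    proof -
      have "Y > 0" using that vB by linarith
      then show "0 < 1 / (v * Y)" "1 / (v * Y) \<le> B" "1 / (v * (1 / (v * Y))) = Y"
        using that v B by (auto simp: field_simps)
    qed
    have "S \<epsilon> \<subseteq> {1 / (v * Yp)..B}"
    proof
      fix x assume x: "x \<in> S \<epsilon>"
      have x0: "0 < x" "x < B" "h x \<ge> \<epsilon>" using x by (auto simp: S_def)
      have "1 / (v * x) \<le> Yp"
      \<comment> \<open>For \<open>x\<close> beyond \<open>2 / v * \<epsilon>\<close> the expansion
        is replaced by a crude bound: \<open>1 / (v * x)\<close> is at most half of
        \<open>1 / \<epsilon>\<close>, and \<open>2 * |a| < 1 / \<epsilon>\<close>.\<close>
      proof (cases "x < 2 / v * \<epsilon>")
        case True
        then have "x < (2 / v) * (\<delta> * v / 2)"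
          by (rule less_trans) (intro mult_strict_left_mono elim, use v in auto)
        then have "x < \<delta>" using v by simp
        have "1 / h x \<le> 1 / \<epsilon>" using x0 elim by (auto simp: frac_le)
        moreover have "\<bar>1 / h x - 1 / (v * x) + a\<bar> \<le> K * x" using expand x0 \<open>x < \<delta>\<close> by auto
        moreover have "K * x \<le> K * (2 / v * \<epsilon>)" using True K by (intro mult_left_mono) auto
        ultimately show ?thesis using CK unfolding Yp_def by linarith
      next
        case False
        then have "2 * \<epsilon> \<le> v * x" using v by (simp add: field_simps)
        then have "1 / (v * x) \<le> 1 / (2 * \<epsilon>)" using elim by (intro frac_le) auto
        also have "\<dots> = N / 2" by (simp add: N_def)
        finally have "1 / (v * x) \<le> N / 2" .
        moreover have "2 * \<bar>a\<bar> < N" unfolding N_def using elim vB C by linarith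
        ultimately show ?thesis using Ce unfolding Yp_def N_def[symmetric] by linarith
      qed
      moreover have "Yp > 0" using Y(1) vB by linarith
      ultimately show "x \<in> {1 / (v * Yp)..B}" using x0 v by (auto simp: field_simps)
    qed
    then have up: "J \<epsilon> \<le> Yp - 1 / (v * B)"
      using int_sub(2)[of "1 / (v * Yp)" \<epsilon>] yB[OF Y(1)] by (simp add: J_def)
    \<comment> \<open>\<open>B\<close> is left out because \<open>S \<epsilon>\<close> lies in an
      open interval; the integral over the closed interval is recovered by discarding a null
      set.\<close>
    have sub: "{1 / (v * Ym)..<B} \<subseteq> S \<epsilon>"
    proof
      fix x assume x: "x \<in> {1 / (v * Ym)..<B}"
      have x0: "0 < x" "x < B" using x less_le_trans[OF yB(1)[OF Y(2)], of x] by auto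
      have le: "1 / (v * x) \<le> Ym" using x v x0 vB Y(2) by (auto simp: field_simps)
      have "h x \<ge> \<epsilon>"
      proof (rule ccontr)
        assume "\<not> h x \<ge> \<epsilon>"
        then have hx: "h x < \<epsilon>" by simp
        have "0 < c * x" using c x0 by simp
        then have hp: "h x > 0" "c * x < \<epsilon>" using lower[OF x0] hx by linarith+
        then have xc: "x < \<epsilon> / c" using c by (simp add: field_simps)
        moreover have "\<epsilon> / c < \<delta>" using elim c by (simp add: field_simps)
        ultimately have "\<bar>1 / h x - 1 / (v * x) + a\<bar> \<le> K * x" using expand x0 by auto
        moreover have "1 / h x > 1 / \<epsilon>" using hp hx by (intro divide_strict_left_mono) auto
        moreover have "K * x \<le> K * (\<epsilon> / c)" using xc K by (intro mult_left_mono) auto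
        ultimately show False using le CK unfolding Ym_def by linarith
      qed
      then show "x \<in> S \<epsilon>" using x0 by (simp add: S_def)
    qed
    have "Ym - 1 / (v * B) = (\<integral>x. 1 / (v * x\<^sup>2) * indicator {1 / (v * Ym)..B} x \<partial>lborel)"
      using has_bochner_integral_integral_eq[OF has_bochner_integral_inverse_square[OF v yB(1,2)[OF Y(2)]]]
        yB(3)[OF Y(2)] by simp
    also have "\<dots> = (\<integral>x. 1 / (v * x\<^sup>2) * indicator {1 / (v * Ym)..<B} x \<partial>lborel)"
      by (rule integral_discrete_difference[where X="{B}"]) (auto simp: indicator_def)
    also have "\<dots> \<le> J \<epsilon>" unfolding J_def
    proof (rule integral_mono)
      have "integrable lborel (\<lambda>x. 1 / (v * x\<^sup>2) * indicator {1 / (v * Ym)..B} x)"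
        using has_bochner_integral_inverse_square[OF v yB(1,2)[OF Y(2)]] by (rule integrable.intros)
      then show "integrable lborel (\<lambda>x. 1 / (v * x\<^sup>2) * indicator {1 / (v * Ym)..<B} x)"
        by (subst integrable_discrete_difference[where X="{B}"]) (auto simp: indicator_def)
      show "integrable lborel (\<lambda>x. 1 / (v * x\<^sup>2) * indicator (S \<epsilon>) x)" using integ elim by simp
      show "1 / (v * x\<^sup>2) * indicator {1 / (v * Ym)..<B} x \<le> 1 / (v * x\<^sup>2) * indicator (S \<epsilon>) x" for x
        using sub v by (auto simp: indicator_def)
    qed
    finally show ?case using up unfolding Yp_def Ym_def by linarith
  qed
  have "((\<lambda>\<epsilon>. J \<epsilon> - 1 / \<epsilon> - (a - 1 / (v * B))) \<longlongrightarrow> 0) (at_right 0)"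
  proof (rule Lim_null_comparison)
    show "\<forall>\<^sub>F \<epsilon> in at_right 0. norm (J \<epsilon> - 1 / \<epsilon> - (a - 1 / (v * B))) \<le> C * \<epsilon>"
      using bounds by simp
    show "((\<lambda>\<epsilon>. C * \<epsilon>) \<longlongrightarrow> 0) (at_right 0)" by (auto intro!: tendsto_eq_intros)
  qed
  then show "((\<lambda>\<epsilon>. (\<integral>x. 1 / (v * x\<^sup>2) * indicator {x \<in> {0<..<B}. h x \<ge> \<epsilon>} x \<partial>lborel) - 1 / \<epsilon>)
           \<longlongrightarrow> a - 1 / (v * B)) (at_right 0)"
    unfolding J_def S_def by (rule LIM_zero_cancel)
qed

text \<open>Local bounds replace continuity because the functions in question may jump at parameters
  that are mapped to infinity.\<close>

lemma locally_bounded_on_compact: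
  fixes f :: "'a::metric_space \<Rightarrow> real"
  assumes "compact S" and loc: "\<And>s. s \<in> S \<Longrightarrow> \<exists>M d. d > 0 \<and> (\<forall>r\<in>ball s d. f r \<le> M)"
  obtains M where "\<And>r. r \<in> S \<Longrightarrow> f r \<le> M"
proof -
  obtain M d where Md: "\<And>s. s \<in> S \<Longrightarrow> d s > 0 \<and> (\<forall>r\<in>ball s (d s). f r \<le> M s)"
    using loc by metis
  obtain C where C: "C \<subseteq> S" "finite C" "S \<subseteq> (\<Union>c\<in>C. ball c (d c))"
    using \<open>compact S\<close> by (rule compactE_image[of S S "\<lambda>s. ball s (d s)"]) (use Md in auto)
  show ?thesis
  proof
    fix r assume "r \<in> S"
    then obtain c where c: "c \<in> C" "r \<in> ball c (d c)" using C by blast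
    then have "f r \<le> M c" using C Md by blast
    also have "M c \<le> Max (M ` C)" using c C by simp
    finally show "f r \<le> Max (M ` C)" .
  qed
qed

text \<open>The truncation enters the limit only through the second-order coefficient \<open>a\<close> of \<open>h\<close> at \<open>t\<close>, and
  there it contributes with opposite signs from the two sides.\<close>

lemma principal_part_regularization:
  fixes W h :: "real \<Rightarrow> real"
  assumes t: "0 < t" "t < 1" and v: "0 < v" and X: "countable X"
    and W_cont: "\<And>s. s \<in> {0<..<1} - {t} - X \<Longrightarrow> isCont W s"
    and W_bdd: "\<And>s. s \<in> {0..1} - {t} \<Longrightarrow> \<exists>M d. d > 0 \<and> (\<forall>r\<in>ball s d. \<bar>W r\<bar> \<le> M)"
    and W_t: "\<exists>K \<delta>. \<delta> > 0 \<and> (\<forall>s. 0 < \<bar>s - t\<bar> \<and> \<bar>s - t\<bar> < \<delta> \<longrightarrow> \<bar>W s - 1 / (v * (s - t)\<^sup>2)\<bar> \<le> K)"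
    and h_cont: "\<And>s. s \<in> {0<..<1} - {t} - X \<Longrightarrow> isCont h s"
    and h_pos: "\<And>s. s \<in> {0..1} - {t} \<Longrightarrow> \<exists>\<eta> d. \<eta> > 0 \<and> d > 0 \<and> (\<forall>r\<in>ball s d. h r \<ge> \<eta>)"
    and h_t: "\<exists>K a \<delta>. \<delta> > 0 \<and> (\<forall>s. 0 < \<bar>s - t\<bar> \<and> \<bar>s - t\<bar> < \<delta> \<longrightarrow> h s > 0 \<and>
               \<bar>1 / h s - 1 / (v * \<bar>s - t\<bar>) + a * sgn (s - t)\<bar> \<le> K * \<bar>s - t\<bar>)"
  shows "((\<lambda>\<epsilon>. (\<integral>s. W s * indicator {s \<in> {0<..<1}. h s \<ge> \<epsilon>} s \<partial>lborel) - 2 / \<epsilon>) \<longlongrightarrow>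
          (\<integral>s. (W s - 1 / (v * (s - t)\<^sup>2)) * indicator {0<..<1} s \<partial>lborel)
            - 1 / (v * t) - 1 / (v * (1 - t))) (at_right 0)"
proof -
  define X' where "X' = X \<union> {0, 1, t}"
  have X': "countable X'" using X by (simp add: X'_def)
  \<comment> \<open>Continuity off a countable set gives Borel measurability; the cut-off to the
    open unit interval adds only the end points 0 and 1 to the exceptions.\<close>
  have meas: "(\<lambda>s. f s * indicator {0<..<1} s) \<in> borel_measurable borel"
    if "\<And>s. s \<in> {0<..<1} - {t} - X \<Longrightarrow> isCont f s" for f :: "real \<Rightarrow> real"
  proof (rule borel_measurable_continuous_countable_exceptions[OF X'], rule continuous_at_imp_continuous_on, rule ballI)
    fix s assume s: "s \<in> - X'"
    have "isCont (indicator {0<..<1::real} :: real \<Rightarrow> real) s"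
      by (rule isCont_indicator[THEN iffD2]) (use s in \<open>auto simp: X'_def frontier_def\<close>)
    then show "isCont (\<lambda>s. f s * indicator {0<..<1} s) s"
    proof (cases "s \<in> {0<..<1}")
      case True
      then have "isCont f s" using that s by (auto simp: X'_def)
      then show ?thesis using \<open>isCont (indicator _) s\<close> by (intro continuous_intros)
    next
      case False
      then have "s \<in> {..<0} \<union> {1<..}" using s by (auto simp: X'_def)
      moreover have "open ({..<0} \<union> {1::real<..})" by auto
      ultimately have "\<forall>\<^sub>F r in nhds s. r \<in> {..<0} \<union> {1<..}" by (intro eventually_nhds_in_open)
      then have "\<forall>\<^sub>F r in nhds s. f r * indicator {0<..<1} r = 0"
        by eventually_elim (auto simp: indicator_def)
      then show ?thesis using isCont_cong[of "\<lambda>s. f s * indicator {0<..<1} s" "\<lambda>_. 0" s] by simp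
    qed
  qed
  define S where "S = (\<lambda>\<epsilon>. {s \<in> {0<..<1}. h s \<ge> \<epsilon>})"
  have S_meas[measurable]: "S \<epsilon> \<in> sets borel" for \<epsilon>
  proof -
    have [measurable]: "(\<lambda>s. h s * indicator {0<..<1} s) \<in> borel_measurable borel"
      by (rule meas) (rule h_cont)
    have "S \<epsilon> = {s \<in> space borel. s \<in> {0<..<1} \<and> h s * indicator {0<..<1} s \<ge> \<epsilon>}"
      by (auto simp: S_def)
    also have "\<dots> \<in> sets borel" by measurable
    finally show ?thesis .
  qed
  obtain K a \<delta> where h_t: "\<delta> > 0" "\<And>s. 0 < \<bar>s - t\<bar> \<Longrightarrow> \<bar>s - t\<bar> < \<delta> \<Longrightarrow> h s > 0"
    "\<And>s. 0 < \<bar>s - t\<bar> \<Longrightarrow> \<bar>s - t\<bar> < \<delta> \<Longrightarrow> \<bar>1 / h s - 1 / (v * \<bar>s - t\<bar>) + a * sgn (s - t)\<bar> \<le> K * \<bar>s - t\<bar>"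
    using h_t by blast
  have h0: "h s > 0" if "s \<in> {0..1}" "s \<noteq> t" for s
    using h_pos[of s] that by (auto dest!: bspec[of _ _ s] intro: less_le_trans)
  \<comment> \<open>A linear lower bound for \<open>h\<close> on the whole interval is obtained by
    bounding \<open>|r - t| / h r\<close> locally: near \<open>t\<close> by the expansion of
    \<open>1 / h\<close>, elsewhere by the local positive lower bound of \<open>h\<close>.\<close>
  have "\<exists>M d. d > 0 \<and> (\<forall>r\<in>ball s d. \<bar>r - t\<bar> / h r \<le> M)" if s: "s \<in> {0..1}" for s
  proof (cases "s = t")
    case True
    have "\<bar>r - t\<bar> / h r \<le> 1 / v + \<bar>a\<bar> * \<delta> + \<bar>K\<bar> * \<delta> * \<delta>" if "\<bar>r - t\<bar> < \<delta>" for r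
    proof (cases "r = t")
      case True
      then show ?thesis using v h_t(1) by simp
    next
      case False
      then have r: "0 < \<bar>r - t\<bar>" by simp
      have "\<bar>a * sgn (r - t)\<bar> \<le> \<bar>a\<bar>" by (auto simp: abs_mult sgn_if)
      moreover have "K * \<bar>r - t\<bar> \<le> \<bar>K\<bar> * \<bar>r - t\<bar>" by (intro mult_right_mono) auto
      ultimately have "1 / h r \<le> 1 / (v * \<bar>r - t\<bar>) + \<bar>a\<bar> + \<bar>K\<bar> * \<bar>r - t\<bar>"
        using h_t(3)[OF r that] by linarith
      then have "\<bar>r - t\<bar> * (1 / h r) \<le> \<bar>r - t\<bar> * (1 / (v * \<bar>r - t\<bar>) + \<bar>a\<bar> + \<bar>K\<bar> * \<bar>r - t\<bar>)"
        by (intro mult_left_mono) auto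
      also have "\<dots> = 1 / v + \<bar>a\<bar> * \<bar>r - t\<bar> + \<bar>K\<bar> * \<bar>r - t\<bar> * \<bar>r - t\<bar>"
        using r v by (simp add: field_simps)
      also have "\<dots> \<le> 1 / v + \<bar>a\<bar> * \<delta> + \<bar>K\<bar> * \<delta> * \<delta>"
        using that h_t(1) by (intro add_mono mult_mono) auto
      finally show ?thesis by simp
    qed
    then show ?thesis using h_t(1) True
      by (intro exI[of _ "1 / v + \<bar>a\<bar> * \<delta> + \<bar>K\<bar> * \<delta> * \<delta>"] exI[of _ \<delta>]) (auto simp: dist_real_def abs_minus_commute)
  next
    case False
    then have "s \<in> {0..1} - {t}" using s by simp
    from h_pos[OF this] obtain \<eta> d where d: "\<eta> > 0" "d > 0" "\<And>r. r \<in> ball s d \<Longrightarrow> h r \<ge> \<eta>" by blast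
    have "\<bar>r - t\<bar> / h r \<le> (\<bar>s - t\<bar> + d) / \<eta>" if "r \<in> ball s d" for r
    proof (rule frac_le)
      show "\<bar>r - t\<bar> \<le> \<bar>s - t\<bar> + d" using that by (auto simp: dist_real_def)
    qed (use d that in auto)
    then show ?thesis using d by blast
  qed
  then obtain C where C: "\<And>s. s \<in> {0..1} \<Longrightarrow> \<bar>s - t\<bar> / h s \<le> C"
    using locally_bounded_on_compact[of "{0..1}" "\<lambda>r. \<bar>r - t\<bar> / h r"] by (metis compact_Icc)
  \<comment> \<open>The maximum with 1 only makes \<open>c\<close> positive.\<close>
  define c where "c = 1 / max C 1"
  have c: "c > 0" by (simp add: c_def)
  have h_lower: "h s \<ge> c * \<bar>s - t\<bar>" if "s \<in> {0<..<1}" "s \<noteq> t" for s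
  proof -
    have "\<bar>s - t\<bar> / h s \<le> max C 1" using C[of s] that by auto
    then show ?thesis using h0[of s] that by (auto simp: c_def field_simps)
  qed
  \<comment> \<open>\<open>P\<close> is the model pole. It is split at \<open>t\<close>, translated
    to 0 and reflected on the left, which gives two one-sided integrals \<open>Pr\<close> and
    \<open>Pl\<close>; the remainder \<open>W - P\<close> is bounded off \<open>t\<close>.\<close>
  define P where "P = (\<lambda>s. 1 / (v * (s - t)\<^sup>2))"
  define Pr where "Pr = (\<lambda>\<epsilon> x. 1 / (v * x\<^sup>2) * indicator {x \<in> {0<..<1 - t}. h (t + x) \<ge> \<epsilon>} x)"
  define Pl where "Pl = (\<lambda>\<epsilon> x. 1 / (v * x\<^sup>2) * indicator {x \<in> {0<..<t}. h (t - x) \<ge> \<epsilon>} x)"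
  have right: "((\<lambda>\<epsilon>. (\<integral>x. Pr \<epsilon> x \<partial>lborel) - 1 / \<epsilon>) \<longlongrightarrow> a - 1 / (v * (1 - t))) (at_right 0)"
       "\<And>\<epsilon>. 0 < \<epsilon> \<Longrightarrow> integrable lborel (Pr \<epsilon>)"
  proof -
    have m: "{x \<in> {0<..<1 - t}. h (t + x) \<ge> \<epsilon>} \<in> sets borel" for \<epsilon>
    proof -
      have "{x \<in> {0<..<1 - t}. h (t + x) \<ge> \<epsilon>} = {x \<in> space borel. x \<in> {0<..<1 - t} \<and> t + x \<in> S \<epsilon>}"
        using t by (auto simp: S_def)
      also have "\<dots> \<in> sets borel" by measurable
      finally show ?thesis .
    qed
    have l: "c * x \<le> h (t + x)" if "0 < x" "x < 1 - t" for x
      using h_lower[of "t + x"] t that by simp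
    have e: "\<bar>1 / h (t + x) - 1 / (v * x) + a\<bar> \<le> \<bar>K\<bar> * x" if "0 < x" "x < \<delta>" for x
    proof -
      have "K * x \<le> \<bar>K\<bar> * x" using \<open>0 < x\<close> by (intro mult_right_mono) auto
      moreover have "\<bar>1 / h (t + x) - 1 / (v * x) + a\<bar> \<le> K * x" using h_t(3)[of "t + x"] that by simp
      ultimately show ?thesis by linarith
    qed
    have "0 < 1 - t" using t by simp
    note * = integral_inverse_square_superlevel[OF v this c h_t(1) abs_ge_zero m l e]
    show "((\<lambda>\<epsilon>. (\<integral>x. Pr \<epsilon> x \<partial>lborel) - 1 / \<epsilon>) \<longlongrightarrow> a - 1 / (v * (1 - t))) (at_right 0)"
       "\<And>\<epsilon>. 0 < \<epsilon> \<Longrightarrow> integrable lborel (Pr \<epsilon>)"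
      unfolding Pr_def by (rule *; assumption?)+
  qed
  have left: "((\<lambda>\<epsilon>. (\<integral>x. Pl \<epsilon> x \<partial>lborel) - 1 / \<epsilon>) \<longlongrightarrow> - a - 1 / (v * t)) (at_right 0)"
       "\<And>\<epsilon>. 0 < \<epsilon> \<Longrightarrow> integrable lborel (Pl \<epsilon>)"
  proof -
    have m: "{x \<in> {0<..<t}. h (t - x) \<ge> \<epsilon>} \<in> sets borel" for \<epsilon>
    proof -
      have "{x \<in> {0<..<t}. h (t - x) \<ge> \<epsilon>} = {x \<in> space borel. x \<in> {0<..<t} \<and> t - x \<in> S \<epsilon>}"
        using t by (auto simp: S_def)
      also have "\<dots> \<in> sets borel" by measurable
      finally show ?thesis .
    qed
    have l: "c * x \<le> h (t - x)" if "0 < x" "x < t" for x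
      using h_lower[of "t - x"] t that by simp
    \<comment> \<open>On this side \<open>sgn (s - t)\<close> is -1, so the coefficient is
      \<open>- a\<close>; it cancels the \<open>a\<close> of the right half in the final
      sum.\<close>
    have e: "\<bar>1 / h (t - x) - 1 / (v * x) + - a\<bar> \<le> \<bar>K\<bar> * x" if "0 < x" "x < \<delta>" for x
    proof -
      have "K * x \<le> \<bar>K\<bar> * x" using \<open>0 < x\<close> by (intro mult_right_mono) auto
      moreover have "\<bar>1 / h (t - x) - 1 / (v * x) + - a\<bar> \<le> K * x" using h_t(3)[of "t - x"] that by simp
      ultimately show ?thesis by linarith
    qed
    have "0 < t" using t by simp
    note * = integral_inverse_square_superlevel[OF v this c h_t(1) abs_ge_zero m l e]
    show "((\<lambda>\<epsilon>. (\<integral>x. Pl \<epsilon> x \<partial>lborel) - 1 / \<epsilon>) \<longlongrightarrow> - a - 1 / (v * (t))) (at_right 0)"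
       "\<And>\<epsilon>. 0 < \<epsilon> \<Longrightarrow> integrable lborel (Pl \<epsilon>)"
      unfolding Pl_def by (rule *; assumption?)+
  qed
  have P_split: "integrable lborel (\<lambda>s. P s * indicator (S \<epsilon>) s)"
      "(\<integral>s. P s * indicator (S \<epsilon>) s \<partial>lborel) = (\<integral>x. Pr \<epsilon> x \<partial>lborel) + (\<integral>x. Pl \<epsilon> x \<partial>lborel)"
    if "0 < \<epsilon>" for \<epsilon>
  proof -
    define fr where "fr = (\<lambda>s. P s * indicator {s \<in> {t<..<1}. h s \<ge> \<epsilon>} s)"
    define fl where "fl = (\<lambda>s. P s * indicator {s \<in> {0<..<t}. h s \<ge> \<epsilon>} s)"
    have split: "P s * indicator (S \<epsilon>) s = fr s + fl s" for s
      using t by (cases "s = t") (auto simp: fr_def fl_def S_def P_def indicator_def)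
    have fr: "fr (t + 1 * x) = Pr \<epsilon> x" for x
      using t by (auto simp: fr_def Pr_def P_def indicator_def)
    have fl: "fl (t + (-1) * x) = Pl \<epsilon> x" for x
      using t by (auto simp: fl_def Pl_def P_def indicator_def)
    have I: "integrable lborel fr" "integrable lborel fl"
      using lborel_integrable_real_affine_iff[of 1 fr t] lborel_integrable_real_affine_iff[of "-1" fl t]
        right(2)[OF that] left(2)[OF that] unfolding fr fl by simp_all
    then show "integrable lborel (\<lambda>s. P s * indicator (S \<epsilon>) s)" unfolding split by simp
    show "(\<integral>s. P s * indicator (S \<epsilon>) s \<partial>lborel) = (\<integral>x. Pr \<epsilon> x \<partial>lborel) + (\<integral>x. Pl \<epsilon> x \<partial>lborel)"
      unfolding split using I lborel_integral_real_affine[of 1 fr t] lborel_integral_real_affine[of "-1" fl t]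
      unfolding fr fl by simp
  qed
  define R where "R = (\<lambda>s. (W s - P s) * indicator {0<..<1} s)"
  have R_meas[measurable]: "R \<in> borel_measurable borel"
    unfolding R_def
  proof (rule meas)
    fix s assume s: "s \<in> {0<..<1} - {t} - X"
    then show "isCont (\<lambda>s. W s - P s) s"
      unfolding P_def using v by (intro continuous_intros W_cont) auto
  qed
  \<comment> \<open>The value at \<open>t\<close> is masked because the expansion of
    \<open>W\<close> says nothing about \<open>W t\<close>.\<close>
  have "\<exists>M d. d > 0 \<and> (\<forall>r\<in>ball s d. \<bar>if r = t then 0 else W r - P r\<bar> \<le> M)" if s: "s \<in> {0..1}" for s
  proof (cases "s = t")
    case True
    obtain K \<delta> where "\<delta> > 0" "\<And>s. 0 < \<bar>s - t\<bar> \<Longrightarrow> \<bar>s - t\<bar> < \<delta> \<Longrightarrow> \<bar>W s - P s\<bar> \<le> K"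
      using W_t unfolding P_def by blast
    then show ?thesis using True
      by (intro exI[of _ "max K 0"] exI[of _ \<delta>]) (auto simp: dist_real_def abs_minus_commute le_max_iff_disj)
  next
    case False
    then have "s \<in> {0..1} - {t}" using s by simp
    from W_bdd[OF this] obtain M d where d: "d > 0" "\<And>r. r \<in> ball s d \<Longrightarrow> \<bar>W r\<bar> \<le> M" by blast
    \<comment> \<open>Halving the distance keeps the ball away from \<open>t\<close>, where
      \<open>P\<close> is unbounded.\<close>
    define d' where "d' = min d (\<bar>s - t\<bar> / 2)"
    have d': "d' > 0" using d False by (auto simp: d'_def)
    have "\<bar>W r - P r\<bar> \<le> M + 1 / (v * (\<bar>s - t\<bar> / 2)\<^sup>2)" if "r \<in> ball s d'" for r
    proof -
      have "\<bar>s - t\<bar> \<le> \<bar>s - r\<bar> + \<bar>r - t\<bar>" by linarith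
      moreover have "\<bar>s - r\<bar> < \<bar>s - t\<bar> / 2" using that unfolding d'_def ball_def dist_real_def mem_Collect_eq min_less_iff_conj by blast
      ultimately have "\<bar>s - t\<bar> / 2 \<le> \<bar>r - t\<bar>" by (simp add: field_simps)
      then have "(\<bar>s - t\<bar> / 2)\<^sup>2 \<le> \<bar>r - t\<bar>\<^sup>2" by (intro power_mono) auto
      then have "P r \<le> 1 / (v * (\<bar>s - t\<bar> / 2)\<^sup>2)" "0 \<le> P r"
        unfolding P_def using False v by (auto intro!: frac_le mult_left_mono)
      moreover have "\<bar>W r\<bar> \<le> M" using d(2) that by (auto simp: d'_def)
      ultimately show ?thesis by linarith
    qed
    moreover have "\<bar>0::real\<bar> \<le> M + 1 / (v * (\<bar>s - t\<bar> / 2)\<^sup>2)"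
      using d(2)[of s] d(1) v by (auto intro!: add_nonneg_nonneg)
    ultimately show ?thesis using d' by (intro exI[of _ "M + 1 / (v * (\<bar>s - t\<bar> / 2)\<^sup>2)"] exI[of _ d']) auto
  qed
  then obtain M where M: "\<And>s. s \<in> {0..1} \<Longrightarrow> \<bar>if s = t then 0 else W s - P s\<bar> \<le> M"
    using locally_bounded_on_compact[of "{0..1}" "\<lambda>r. \<bar>if r = t then 0 else W r - P r\<bar>"] by (metis compact_Icc)
  \<comment> \<open>At \<open>t\<close> the division by zero makes \<open>P t = 0\<close>, so the
    remainder there is \<open>W t\<close>; the maximum lets the dominating function cover this
    single point too.\<close>
  define N where "N = (\<lambda>s::real. max M \<bar>W t\<bar> * indicator {0<..<1} s)"
  have N_int: "integrable lborel N" by (simp add: N_def)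
  have RN: "\<bar>R s\<bar> \<le> N s" for s
    using M[of s] by (auto simp: R_def N_def P_def indicator_def le_max_iff_disj split: if_splits)
  have RS_int: "integrable lborel (\<lambda>s. R s * indicator (S \<epsilon>) s)" for \<epsilon>
    by (rule Bochner_Integration.integrable_bound[OF N_int])
      (use order_trans[OF RN abs_ge_self] in \<open>auto intro!: AE_I2 simp: indicator_def\<close>)
  \<comment> \<open>Dominated convergence along sequences: at every \<open>s \<noteq> t\<close> in
    the interval \<open>h s > 0\<close>, so the truncation eventually keeps
    \<open>s\<close>.\<close>
  have R_lim: "((\<lambda>\<epsilon>. \<integral>s. R s * indicator (S \<epsilon>) s \<partial>lborel) \<longlongrightarrow> (\<integral>s. R s \<partial>lborel)) (at_right 0)"
  proof (rule tendsto_at_right_sequentially[of 0 1])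
    fix e :: "nat \<Rightarrow> real" assume e: "\<And>n. 0 < e n" "e \<longlonglongrightarrow> 0"
    show "(\<lambda>n. \<integral>s. R s * indicator (S (e n)) s \<partial>lborel) \<longlonglongrightarrow> (\<integral>s. R s \<partial>lborel)"
    proof (rule integral_dominated_convergence[OF _ _ N_int])
      have "AE s in lborel. s \<noteq> t" by (rule AE_lborel_singleton)
      then show "AE s in lborel. (\<lambda>n. R s * indicator (S (e n)) s) \<longlonglongrightarrow> R s"
      proof eventually_elim
        case (elim s)
        show ?case
        proof (cases "s \<in> {0<..<1}")
          case True
          then have "h s > 0" using h0 elim by simp
          then have "\<forall>\<^sub>F n in sequentially. e n < h s" using e(2) by (rule order_tendstoD(2)[rotated])
          then have "\<forall>\<^sub>F n in sequentially. R s * indicator (S (e n)) s = R s"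
            by eventually_elim (use True in \<open>auto simp: S_def\<close>)
          then show ?thesis by (rule tendsto_eventually)
        qed (simp add: R_def)
      qed
      show "AE s in lborel. norm (R s * indicator (S (e n)) s) \<le> N s" for n
        using RN by (auto intro!: AE_I2 simp: indicator_def intro: order_trans[OF abs_ge_zero])
    qed auto
  qed simp
  have "((\<lambda>\<epsilon>. (\<integral>s. R s * indicator (S \<epsilon>) s \<partial>lborel) + (((\<integral>x. Pr \<epsilon> x \<partial>lborel) - 1 / \<epsilon>) + ((\<integral>x. Pl \<epsilon> x \<partial>lborel) - 1 / \<epsilon>)))
     \<longlongrightarrow> (\<integral>s. R s \<partial>lborel) + ((a - 1 / (v * (1 - t))) + (- a - 1 / (v * t)))) (at_right 0)"
    by (intro tendsto_add R_lim right left)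
  moreover have "\<forall>\<^sub>F \<epsilon> in at_right 0. (\<integral>s. R s * indicator (S \<epsilon>) s \<partial>lborel) + (((\<integral>x. Pr \<epsilon> x \<partial>lborel) - 1 / \<epsilon>) + ((\<integral>x. Pl \<epsilon> x \<partial>lborel) - 1 / \<epsilon>))
      = (\<integral>s. W s * indicator {s \<in> {0<..<1}. h s \<ge> \<epsilon>} s \<partial>lborel) - 2 / \<epsilon>"
    using eventually_at_right_less[of "0::real"]
  proof eventually_elim
    case (elim \<epsilon>)
    have "(\<integral>s. W s * indicator (S \<epsilon>) s \<partial>lborel) = (\<integral>s. R s * indicator (S \<epsilon>) s + P s * indicator (S \<epsilon>) s \<partial>lborel)"
      by (intro Bochner_Integration.integral_cong) (auto simp: R_def S_def indicator_def)
    also have "\<dots> = (\<integral>s. R s * indicator (S \<epsilon>) s \<partial>lborel) + (\<integral>s. P s * indicator (S \<epsilon>) s \<partial>lborel)"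
      by (intro Bochner_Integration.integral_add RS_int P_split elim)
    finally show ?case using P_split(2)[OF elim] by (simp add: S_def)
  qed
  ultimately have "((\<lambda>\<epsilon>. (\<integral>s. W s * indicator {s \<in> {0<..<1}. h s \<ge> \<epsilon>} s \<partial>lborel) - 2 / \<epsilon>)
     \<longlongrightarrow> (\<integral>s. R s \<partial>lborel) + ((a - 1 / (v * (1 - t))) + (- a - 1 / (v * t)))) (at_right 0)"
    by (rule Lim_transform_eventually)
  then show ?thesis by (simp add: R_def P_def algebra_simps)
qed

section \<open>Second-order expansions\<close>

definition jet :: "(real \<Rightarrow> 'a::real_normed_vector) \<Rightarrow> 'a \<Rightarrow> 'a \<Rightarrow> bool" where
  "jet f a b \<longleftrightarrow> (\<exists>K. \<forall>\<^sub>F x in at 0. norm (f x - a - x *\<^sub>R b) \<le> K * x\<^sup>2)"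

lemma jetI:
  assumes "\<forall>\<^sub>F x in at 0. norm (f x - a - x *\<^sub>R b) \<le> K * x\<^sup>2"
  shows "jet f a b"
  using assms by (auto simp: jet_def)

lemma eventually_small_at_0: "\<forall>\<^sub>F x in at (0::real). 0 < \<bar>x\<bar> \<and> \<bar>x\<bar> \<le> 1"
  by (auto simp: eventually_at intro!: exI[of _ 1])

lemma jetE:
  assumes "jet f a b"
  obtains K where "K \<ge> 0" "\<forall>\<^sub>F x in at 0. norm (f x - a - x *\<^sub>R b) \<le> K * x\<^sup>2"
proof -
  obtain K where K: "\<forall>\<^sub>F x in at 0. norm (f x - a - x *\<^sub>R b) \<le> K * x\<^sup>2"
    using assms by (auto simp: jet_def)
  have "\<forall>\<^sub>F x in at 0. norm (f x - a - x *\<^sub>R b) \<le> \<bar>K\<bar> * x\<^sup>2"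
    using K by eventually_elim (erule order_trans, intro mult_right_mono, auto)
  then show ?thesis using that[of "\<bar>K\<bar>"] by simp
qed

lemma jet_const: "jet (\<lambda>x. c) c 0"
  by (rule jetI[of _ _ _ 0]) simp

lemma jet_bounded_linear:
  assumes "jet f a b" "bounded_linear L"
  shows "jet (\<lambda>x. L (f x)) (L a) (L b)"
proof -
  interpret bounded_linear L by fact
  obtain C where C: "C > 0" "\<And>x. norm (L x) \<le> norm x * C" using pos_bounded by blast
  obtain K where "K \<ge> 0" and K: "\<forall>\<^sub>F x in at 0. norm (f x - a - x *\<^sub>R b) \<le> K * x\<^sup>2"
    using assms(1) by (rule jetE)
  show ?thesis
  proof (rule jetI)
    show "\<forall>\<^sub>F x in at 0. norm (L (f x) - L a - x *\<^sub>R L b) \<le> (K * C) * x\<^sup>2"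
      using K
    proof eventually_elim
      case (elim x)
      have "L (f x) - L a - x *\<^sub>R L b = L (f x - a - x *\<^sub>R b)" by (simp add: diff scale)
      also have "norm \<dots> \<le> norm (f x - a - x *\<^sub>R b) * C" by (rule C)
      also have "\<dots> \<le> K * x\<^sup>2 * C" using elim C by (intro mult_right_mono) auto
      finally show ?case by (simp add: mult_ac)
    qed
  qed
qed

lemma jet_Pair:
  assumes "jet f a b" "jet g c d"
  shows "jet (\<lambda>x. (f x, g x)) (a, c) (b, d)"
proof -
  obtain K where K: "K \<ge> 0" "\<forall>\<^sub>F x in at 0. norm (f x - a - x *\<^sub>R b) \<le> K * x\<^sup>2"
    using assms(1) by (rule jetE)
  obtain K' where K': "K' \<ge> 0" "\<forall>\<^sub>F x in at 0. norm (g x - c - x *\<^sub>R d) \<le> K' * x\<^sup>2"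
    using assms(2) by (rule jetE)
  show ?thesis
  proof (rule jetI)
    show "\<forall>\<^sub>F x in at 0. norm ((f x, g x) - (a, c) - x *\<^sub>R (b, d)) \<le> (K + K') * x\<^sup>2"
      using K(2) K'(2)
      by eventually_elim (auto simp: algebra_simps intro: order_trans[OF norm_Pair_le])
  qed
qed

lemma jet_tendsto:
  assumes "jet f a b"
  shows "(f \<longlongrightarrow> a) (at 0)"
proof -
  obtain K where K: "K \<ge> 0" "\<forall>\<^sub>F x in at 0. norm (f x - a - x *\<^sub>R b) \<le> K * x\<^sup>2"
    using assms by (rule jetE)
  have "((\<lambda>x. f x - a - x *\<^sub>R b) \<longlongrightarrow> 0) (at 0)"
    by (rule Lim_null_comparison[OF K(2)]) (auto intro!: tendsto_eq_intros)
  then have "((\<lambda>x. (f x - a - x *\<^sub>R b) + x *\<^sub>R b + a) \<longlongrightarrow> 0 + 0 *\<^sub>R b + a) (at 0)"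
    by (intro tendsto_intros)
  then show ?thesis by simp
qed

lemma jet_mult:
  fixes f g :: "real \<Rightarrow> 'a::real_normed_algebra"
  assumes "jet f a b" "jet g c d"
  shows "jet (\<lambda>x. f x * g x) (a * c) (a * d + b * c)"
proof -
  obtain K where K: "K \<ge> 0" "\<forall>\<^sub>F x in at 0. norm (f x - a - x *\<^sub>R b) \<le> K * x\<^sup>2"
    using assms(1) by (rule jetE)
  obtain K' where K': "K' \<ge> 0" "\<forall>\<^sub>F x in at 0. norm (g x - c - x *\<^sub>R d) \<le> K' * x\<^sup>2"
    using assms(2) by (rule jetE)
  have "\<forall>\<^sub>F x in at 0. norm (g x) < norm c + 1"
    using tendsto_norm[OF jet_tendsto[OF assms(2)]] by (rule order_tendstoD) simp
  then show ?thesis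
    using K(2) K'(2) eventually_small_at_0
  proof (intro jetI, eventually_elim)
    case (elim x)
    have "f x * g x - a * c - x *\<^sub>R (a * d + b * c) =
        (f x - a - x *\<^sub>R b) * g x + (a + x *\<^sub>R b) * (g x - c - x *\<^sub>R d) + x\<^sup>2 *\<^sub>R (b * d)"
      by (simp add: algebra_simps power2_eq_square scaleR_add_right)
    also have "norm \<dots> \<le> K * x\<^sup>2 * (norm c + 1) + (norm a + norm b) * (K' * x\<^sup>2) + x\<^sup>2 * (norm b * norm d)"
    proof (intro norm_add_rule_thm)
      show "norm ((f x - a - x *\<^sub>R b) * g x) \<le> K * x\<^sup>2 * (norm c + 1)"
        by (rule order_trans[OF norm_mult_ineq], intro mult_mono) (use elim K in auto)
      have "norm (x *\<^sub>R b) \<le> 1 * norm b" unfolding norm_scaleR using elim by (intro mult_right_mono) auto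
      then have "norm (a + x *\<^sub>R b) \<le> norm a + norm b"
        using norm_triangle_ineq[of a "x *\<^sub>R b"] by linarith
      then show "norm ((a + x *\<^sub>R b) * (g x - c - x *\<^sub>R d)) \<le> (norm a + norm b) * (K' * x\<^sup>2)"
        by (intro order_trans[OF norm_mult_ineq] mult_mono) (use elim K' in auto)
      show "norm (x\<^sup>2 *\<^sub>R (b * d)) \<le> x\<^sup>2 * (norm b * norm d)"
        by (simp add: norm_mult_ineq mult_left_mono)
    qed
    also have "\<dots> = (K * (norm c + 1) + (norm a + norm b) * K' + norm b * norm d) * x\<^sup>2"
      by (simp add: algebra_simps)
    finally show "norm (f x * g x - a * c - x *\<^sub>R (a * d + b * c))
       \<le> (K * (norm c + 1) + (norm a + norm b) * K' + norm b * norm d) * x\<^sup>2" .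
  qed
qed

lemma jet_compose:
  fixes f :: "real \<Rightarrow> real"
  assumes "jet f a b" "0 < d"
    and \<phi>: "\<And>y. \<bar>y - a\<bar> < d \<Longrightarrow> \<bar>\<phi> y - \<phi> a - (y - a) * \<phi>'\<bar> \<le> C * (y - a)\<^sup>2"
  shows "jet (\<lambda>x. \<phi> (f x)) (\<phi> a) (\<phi>' * b)"
proof -
  obtain K where K: "K \<ge> 0" "\<forall>\<^sub>F x in at 0. norm (f x - a - x *\<^sub>R b) \<le> K * x\<^sup>2"
    using assms(1) by (rule jetE)
  have "\<forall>\<^sub>F x in at 0. dist (f x) a < d"
    using jet_tendsto[OF assms(1)] \<open>0 < d\<close> by (rule tendstoD)
  then show ?thesis
    using K(2) eventually_small_at_0
  proof (intro jetI, eventually_elim)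
    case (elim x)
    have "\<bar>f x - a\<bar> \<le> (K + \<bar>b\<bar>) * \<bar>x\<bar>"
    proof -
      have "\<bar>f x - a\<bar> \<le> K * x\<^sup>2 + \<bar>x * b\<bar>" using elim by simp
      moreover have "\<bar>x\<bar> * \<bar>x\<bar> \<le> \<bar>x\<bar> * 1" using elim by (intro mult_left_mono) auto
      then have "K * x\<^sup>2 \<le> K * \<bar>x\<bar>"
        using K(1) by (intro mult_left_mono) (auto simp: power2_eq_square)
      ultimately show ?thesis by (simp add: abs_mult algebra_simps)
    qed
    then have "(f x - a)\<^sup>2 \<le> ((K + \<bar>b\<bar>) * \<bar>x\<bar>)\<^sup>2" by (rule power2_le_iff_abs_le[THEN iffD2, rotated]) (use K in auto)
    then have sq: "(f x - a)\<^sup>2 \<le> (K + \<bar>b\<bar>)\<^sup>2 * x\<^sup>2" by (simp add: power_mult_distrib)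
    have "\<bar>\<phi> (f x) - \<phi> a - (f x - a) * \<phi>'\<bar> \<le> \<bar>C\<bar> * (f x - a)\<^sup>2"
      using \<phi>[of "f x"] elim by (intro order_trans[OF \<phi>] mult_right_mono) (auto simp: dist_real_def)
    also have "\<dots> \<le> \<bar>C\<bar> * ((K + \<bar>b\<bar>)\<^sup>2 * x\<^sup>2)" using sq by (intro mult_left_mono) auto
    finally have 1: "\<bar>\<phi> (f x) - \<phi> a - (f x - a) * \<phi>'\<bar> \<le> \<bar>C\<bar> * (K + \<bar>b\<bar>)\<^sup>2 * x\<^sup>2" by (simp add: mult_ac)
    have "\<bar>(f x - a - x * b) * \<phi>'\<bar> \<le> K * x\<^sup>2 * \<bar>\<phi>'\<bar>"
      unfolding abs_mult using elim by (intro mult_right_mono) auto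
    moreover have "\<phi> (f x) - \<phi> a - x *\<^sub>R (\<phi>' * b) = (\<phi> (f x) - \<phi> a - (f x - a) * \<phi>') + (f x - a - x * b) * \<phi>'"
      by (simp add: algebra_simps)
    ultimately show "norm (\<phi> (f x) - \<phi> a - x *\<^sub>R (\<phi>' * b)) \<le> (\<bar>C\<bar> * (K + \<bar>b\<bar>)\<^sup>2 + K * \<bar>\<phi>'\<bar>) * x\<^sup>2"
      using 1 by (simp add: algebra_simps)
  qed
qed

lemma jet_sqrt:
  assumes "jet f a b" "0 < a"
  shows "jet (\<lambda>x. sqrt (f x)) (sqrt a) (b / (2 * sqrt a))"
proof -
  have "jet (\<lambda>x. sqrt (f x)) (sqrt a) (1 / (2 * sqrt a) * b)"
  proof (rule jet_compose[OF assms])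
    fix y assume "\<bar>y - a\<bar> < a"
    then have y: "y > 0" by linarith
    define r q where "r = sqrt y" and "q = sqrt a"
    have rq: "r > 0" "q > 0" "y = r\<^sup>2" "a = q\<^sup>2" using y assms by (auto simp: r_def q_def)
    have "r - q - (r\<^sup>2 - q\<^sup>2) * (1 / (2 * q)) = - (r - q)\<^sup>2 / (2 * q)"
      using rq by (simp add: field_simps power2_eq_square)
    then have "\<bar>r - q - (r\<^sup>2 - q\<^sup>2) * (1 / (2 * q))\<bar> = (r - q)\<^sup>2 / (2 * q)" using rq by simp
    also have "r\<^sup>2 - q\<^sup>2 = (r - q) * (r + q)" by (simp add: power2_eq_square algebra_simps)
    then have "(r - q)\<^sup>2 = (r\<^sup>2 - q\<^sup>2)\<^sup>2 / (r + q)\<^sup>2"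
      using rq by (simp add: power_mult_distrib)
    also have "\<dots> \<le> (r\<^sup>2 - q\<^sup>2)\<^sup>2 / q\<^sup>2"
      using rq by (intro divide_left_mono power_mono) auto
    also have "(r\<^sup>2 - q\<^sup>2)\<^sup>2 / q\<^sup>2 / (2 * q) = 1 / (2 * q ^ 3) * (r\<^sup>2 - q\<^sup>2)\<^sup>2"
      using rq by (simp add: power2_eq_square power3_eq_cube)
    finally show "\<bar>sqrt y - sqrt a - (y - a) * (1 / (2 * sqrt a))\<bar> \<le> 1 / (2 * sqrt a ^ 3) * (y - a)\<^sup>2"
      using rq by (simp add: r_def[symmetric] q_def[symmetric] divide_right_mono)
  qed
  then show ?thesis by simp
qed

lemma jet_inverse:
  fixes f :: "real \<Rightarrow> real"
  assumes "jet f a b" "0 < a"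
  shows "jet (\<lambda>x. 1 / f x) (1 / a) (- b / a\<^sup>2)"
proof -
  have "jet (\<lambda>x. 1 / f x) (1 / a) ((- 1 / a\<^sup>2) * b)"
  proof (rule jet_compose[OF assms(1), of "a / 2"])
    fix y assume "\<bar>y - a\<bar> < a / 2"
    then have y: "y > a / 2" by linarith
    then have "y > 0" using assms by linarith
    have "1 / y - 1 / a - (y - a) * (- 1 / a\<^sup>2) = (y - a)\<^sup>2 / (y * a\<^sup>2)"
      using \<open>y > 0\<close> assms by (simp add: field_simps power2_eq_square)
    also have "\<dots> \<le> (y - a)\<^sup>2 / ((a / 2) * a\<^sup>2)"
      using y assms \<open>y > 0\<close> by (intro divide_left_mono mult_right_mono) auto
    finally have "1 / y - 1 / a - (y - a) * (- 1 / a\<^sup>2) \<le> (y - a)\<^sup>2 / ((a / 2) * a\<^sup>2)" .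
    moreover have "0 \<le> 1 / y - 1 / a - (y - a) * (- 1 / a\<^sup>2)"
      using \<open>y > 0\<close> assms \<open>1 / y - 1 / a - (y - a) * (- 1 / a\<^sup>2) = (y - a)\<^sup>2 / (y * a\<^sup>2)\<close> by simp
    ultimately show "\<bar>1 / y - 1 / a - (y - a) * (- 1 / a\<^sup>2)\<bar> \<le> 1 / ((a / 2) * a\<^sup>2) * (y - a)\<^sup>2"
      unfolding times_divide_eq_left mult_1_left by (metis abs_of_nonneg)
  qed (use assms in simp)
  then show ?thesis by simp
qed

text \<open>The modulus is the square root of the real part of \<open>f x * cnj (f x)\<close>, so
  the product and square root rules suffice.\<close>

lemma jet_cmod:
  assumes "jet f a b" "a \<noteq> 0"
  shows "jet (\<lambda>x. cmod (f x)) (cmod a) (Re (cnj a * b) / cmod a)"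
proof -
  have "jet (\<lambda>x. f x * cnj (f x)) (a * cnj a) (a * cnj b + b * cnj a)"
    by (intro jet_mult jet_bounded_linear[OF _ bounded_linear_cnj] assms)
  from jet_bounded_linear[OF this bounded_linear_Re]
  have "jet (\<lambda>x. (cmod (f x))\<^sup>2) ((cmod a)\<^sup>2) (2 * Re (cnj a * b))"
    by (simp add: complex_mult_cnj cmod_power2 mult_ac flip: complex_norm_square)
  from jet_sqrt[OF this] assms(2)
  have "jet (\<lambda>x. cmod (f x)) (cmod a) (2 * Re (cnj a * b) / (2 * cmod a))" by simp
  moreover have "2 * r / (2 * q) = r / q" for r q :: real by simp
  ultimately show ?thesis by (simp only:)
qed

lemma norm_le_of_derivative_bound:
  fixes f :: "real \<Rightarrow> 'a::euclidean_space"
  assumes der: "\<forall>\<^sub>F x in nhds 0. (f has_vector_derivative f' x) (at x)"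
    and bound: "\<forall>\<^sub>F x in at 0. norm (f' x) \<le> K * \<bar>x\<bar> ^ n"
    and "f 0 = 0" "K \<ge> 0"
  shows "\<forall>\<^sub>F x in at 0. norm (f x) \<le> K * \<bar>x\<bar> ^ Suc n"
proof -
  obtain d1 where d1: "d1 > 0" "\<And>x. \<bar>x\<bar> < d1 \<Longrightarrow> (f has_vector_derivative f' x) (at x)"
    using der by (auto simp: eventually_nhds_metric dist_real_def)
  obtain d2 where d2: "d2 > 0" "\<And>x. x \<noteq> 0 \<Longrightarrow> \<bar>x\<bar> < d2 \<Longrightarrow> norm (f' x) \<le> K * \<bar>x\<bar> ^ n"
    using bound by (auto simp: eventually_at dist_real_def)
  \<comment> \<open>One end point is 0, so \<open>b - a\<close> bounds the modulus of every
    intermediate point; the mean value point is interior, hence nonzero, and the punctured bound on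
    \<open>f'\<close> applies there.\<close>
  have main: "norm (f b - f a) \<le> K * (b - a) ^ Suc n"
    if "a < b" "a = 0 \<or> b = 0" "\<bar>a\<bar> < min d1 d2" "\<bar>b\<bar> < min d1 d2" for a b
  proof -
    have der: "(f has_derivative (\<lambda>h. h *\<^sub>R f' x)) (at x)" if "a \<le> x" "x \<le> b" for x
    proof -
      have "\<bar>x\<bar> < d1" using that \<open>\<bar>a\<bar> < min d1 d2\<close> \<open>\<bar>b\<bar> < min d1 d2\<close> by linarith
      then show ?thesis using d1(2) by (simp add: has_vector_derivative_def)
    qed
    obtain x where x: "x \<in> {a<..<b}" "norm (f b - f a) \<le> norm ((b - a) *\<^sub>R f' x)"
    proof -
      have "continuous_on {a..b} f"
        by (intro continuous_at_imp_continuous_on ballI has_derivative_continuous[OF der]) auto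
      from mvt_general[OF \<open>a < b\<close> this der] show ?thesis using that by auto
    qed
    have "x \<noteq> 0" "\<bar>x\<bar> < d2" using x that by auto
    then have "norm (f' x) \<le> K * \<bar>x\<bar> ^ n" by (rule d2)
    also have "\<dots> \<le> K * (b - a) ^ n" using x that \<open>K \<ge> 0\<close> by (intro mult_left_mono power_mono) auto
    finally have "(b - a) * norm (f' x) \<le> (b - a) * (K * (b - a) ^ n)" using \<open>a < b\<close> by (intro mult_left_mono) auto
    with x(2) have "norm (f b - f a) \<le> (b - a) * (K * (b - a) ^ n)"
      using \<open>a < b\<close> by (auto intro: order_trans mult_left_mono)
    then show ?thesis by (simp add: mult_ac)
  qed
  show ?thesis
    unfolding eventually_at
  proof (intro exI[of _ "min d1 d2"] conjI ballI impI)
    fix x :: real assume x: "x \<noteq> 0 \<and> dist x 0 < min d1 d2"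
    show "norm (f x) \<le> K * \<bar>x\<bar> ^ Suc n"
    proof (cases "x > 0")
      case True
      then show ?thesis using main[of 0 x] x d1 d2 \<open>f 0 = 0\<close> by simp
    next
      case False
      then show ?thesis using main[of x 0] x d1 d2 \<open>f 0 = 0\<close> by simp
    qed
  qed (use d1 d2 in auto)
qed

text \<open>Termwise integration: \<open>x^n (a + b x + O(x^2))\<close> integrates to
  \<open>x^(n+1) (a / (n+1) + b x / (n+2) + O(x^2))\<close>. This reaches the third-order
  coefficient of the pairing without third-order Taylor formulas.\<close>

lemma jet_integrate:
  fixes f :: "real \<Rightarrow> 'a::euclidean_space"
  assumes der: "\<forall>\<^sub>F x in nhds 0. (f has_vector_derivative f' x) (at x)"
    and f': "jet (\<lambda>x. (1 / x ^ n) *\<^sub>R f' x) a b"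
    and "f 0 = 0"
  shows "jet (\<lambda>x. (1 / x ^ Suc n) *\<^sub>R f x) (a /\<^sub>R (n + 1)) (b /\<^sub>R (n + 2))"
proof -
  obtain K where K: "K \<ge> 0" "\<forall>\<^sub>F x in at 0. norm ((1 / x ^ n) *\<^sub>R f' x - a - x *\<^sub>R b) \<le> K * x\<^sup>2"
    using f' by (rule jetE)
  define g where "g = (\<lambda>x. f x - (x ^ (n + 1) / (n + 1)) *\<^sub>R a - (x ^ (n + 2) / (n + 2)) *\<^sub>R b)"
  define g' where "g' = (\<lambda>x. f' x - (x ^ n) *\<^sub>R a - (x ^ (n + 1)) *\<^sub>R b)"
  have "\<forall>\<^sub>F x in at 0. norm (g x) \<le> K * \<bar>x\<bar> ^ Suc (n + 2)"
  proof (rule norm_le_of_derivative_bound)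
    have pw: "((\<lambda>x. x ^ Suc m / Suc m) has_real_derivative x ^ m) (at x)" for m and x :: real
      using DERIV_cdivide[OF DERIV_pow[of "Suc m" x], of "Suc m"] by (simp del: power_Suc of_nat_Suc)
    show "\<forall>\<^sub>F x in nhds 0. (g has_vector_derivative g' x) (at x)"
      using der
    proof eventually_elim
      case (elim x)
      show ?case unfolding g_def g'_def
        using has_vector_derivative_diff[OF has_vector_derivative_diff[OF elim
            has_vector_derivative_scaleR[OF pw[of n] has_vector_derivative_const]]
            has_vector_derivative_scaleR[OF pw[of "n + 1"] has_vector_derivative_const], of a b]
        by (simp add: add_ac)
    qed
    show "\<forall>\<^sub>F x in at 0. norm (g' x) \<le> K * \<bar>x\<bar> ^ (n + 2)"
      using K(2) eventually_small_at_0
    proof eventually_elim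
      case (elim x)
      have "g' x = x ^ n *\<^sub>R ((1 / x ^ n) *\<^sub>R f' x - a - x *\<^sub>R b)"
        using elim by (simp add: g'_def algebra_simps)
      then have "norm (g' x) = \<bar>x\<bar> ^ n * norm ((1 / x ^ n) *\<^sub>R f' x - a - x *\<^sub>R b)"
        by (simp add: power_abs)
      also have "\<dots> \<le> \<bar>x\<bar> ^ n * (K * x\<^sup>2)" using elim by (intro mult_left_mono) auto
      also have "\<dots> = K * \<bar>x\<bar> ^ (n + 2)" by (simp add: power_add power2_eq_square)
      finally show ?case .
    qed
    show "g 0 = 0" using assms by (simp add: g_def)
  qed fact
  then show ?thesis
    using eventually_small_at_0
  proof (intro jetI, eventually_elim)
    case (elim x)
    have "g x = x ^ Suc n *\<^sub>R ((1 / x ^ Suc n) *\<^sub>R f x - a /\<^sub>R (n + 1) - x *\<^sub>R (b /\<^sub>R (n + 2)))"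
      using elim by (simp add: g_def algebra_simps divide_inverse)
    then have "\<bar>x\<bar> ^ Suc n * norm ((1 / x ^ Suc n) *\<^sub>R f x - a /\<^sub>R (n + 1) - x *\<^sub>R (b /\<^sub>R (n + 2))) = norm (g x)"
      by (simp add: power_abs abs_mult)
    also have "\<dots> \<le> \<bar>x\<bar> ^ Suc n * (K * x\<^sup>2)" using elim by (simp add: power2_eq_square mult_ac)
    finally show "norm ((1 / x ^ Suc n) *\<^sub>R f x - a /\<^sub>R (n + 1) - x *\<^sub>R (b /\<^sub>R (n + 2))) \<le> K * x\<^sup>2"
      by (rule mult_left_le_imp_le) (use elim in auto)
  qed
qed

lemma jet_of_second_derivative:
  fixes f :: "real \<Rightarrow> 'a::euclidean_space"
  assumes der: "\<forall>\<^sub>F x in nhds 0. (f has_vector_derivative f' x) (at x)"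
    and der': "\<forall>\<^sub>F x in nhds 0. (f' has_vector_derivative f'' x) (at x)"
    and cont: "isCont f'' 0"
  shows "jet f (f 0) (f' 0)"
proof -
  define K where "K = norm (f'' 0) + 1"
  have "\<forall>\<^sub>F x in at 0. norm (f'' x) < K"
    using tendsto_norm[OF cont[unfolded isCont_def]] by (rule order_tendstoD) (simp add: K_def)
  then have bound: "\<forall>\<^sub>F x in at 0. norm (f'' x) \<le> K * \<bar>x\<bar> ^ 0" by eventually_elim simp
  have "\<forall>\<^sub>F x in nhds 0. ((\<lambda>x. f' x - f' 0) has_vector_derivative f'' x) (at x)"
    using der' by eventually_elim (auto intro!: derivative_eq_intros)
  from norm_le_of_derivative_bound[OF this bound]
  have bound': "\<forall>\<^sub>F x in at 0. norm (f' x - f' 0) \<le> K * \<bar>x\<bar> ^ 1" by (simp add: K_def)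
  have "\<forall>\<^sub>F x in nhds 0. ((\<lambda>x. f x - f 0 - x *\<^sub>R f' 0) has_vector_derivative f' x - f' 0) (at x)"
    using der by eventually_elim (auto intro!: derivative_eq_intros)
  from norm_le_of_derivative_bound[OF this bound']
  have "\<forall>\<^sub>F x in at 0. norm (f x - f 0 - x *\<^sub>R f' 0) \<le> K * \<bar>x\<bar> ^ Suc 1" by (simp add: K_def)
  then show ?thesis by (intro jetI[of _ _ _ K]) (simp add: power2_eq_square)
qed

section \<open>The null cone model\<close>

type_synonym cvec = "complex \<times> complex \<times> complex"

text \<open>Conjugate-linear in the first argument and of signature (1,2): the Siegel model, in
  which the null lines form the boundary of the complex hyperbolic plane.\<close>

definition herm :: "cvec \<Rightarrow> cvec \<Rightarrow> complex" where
  "herm v w = cnj (fst v) * snd (snd w) + cnj (snd (snd v)) * fst w - 2 * cnj (fst (snd v)) * fst (snd w)"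

definition cscale :: "complex \<Rightarrow> cvec \<Rightarrow> cvec" where
  "cscale k v = (k * fst v, k * fst (snd v), k * snd (snd v))"

definition lift :: "hpt \<Rightarrow> cvec" where
  "lift p = (1, fst p, Complex ((cmod (fst p))\<^sup>2) (4 * snd p))"

text \<open>On a null vector with nonzero first coordinate, the real part of the third quotient is
  forced to be \<open>|z|^2\<close>, so only its imaginary part carries information. The only null
  line with first coordinate 0 is spanned by \<open>(0, 0, 1)\<close>, which stands for
  infinity.\<close>

definition proj :: "cvec \<Rightarrow> hpt option" where
  "proj v = (if fst v = 0 then None else Some (fst (snd v) / fst v, Im (snd (snd v) / fst v) / 4))"

section \<open>Null vectors and the Koranyi distance\<close>

lemma cmod_times_cmod: "cmod z * cmod z = Re z * Re z + Im z * Im z"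
  using cmod_power2[of z] by (simp add: power2_eq_square)

lemma herm_cscale_left: "herm (cscale k v) w = cnj k * herm v w"
  and herm_cscale_right: "herm v (cscale k w) = k * herm v w"
  by (simp_all add: herm_def cscale_def algebra_simps)

lemma fst_cscale [simp]: "fst (cscale k v) = k * fst v"
  by (simp add: cscale_def)

lemma fst_lift [simp]: "fst (lift p) = 1"
  by (simp add: lift_def)

lemma lift_nonzero [simp]: "lift p \<noteq> 0"
  by (simp add: lift_def zero_prod_def)

lemma proj_lift [simp]: "proj (lift p) = Some p"
  by (simp add: proj_def lift_def)

lemma herm_lift_self: "herm (lift p) (lift p) = 0"
  by (simp add: herm_def lift_def complex_eq_iff cmod_times_cmod power2_eq_square algebra_simps)

lemma proj_eq_Some:
  assumes "herm v v = 0" "proj v = Some p"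
  shows "fst v \<noteq> 0" "v = cscale (fst v) (lift p)"
proof -
  obtain a b c where v: "v = (a, b, c)" by (cases v)
  show a: "fst v \<noteq> 0" using assms(2) by (auto simp: proj_def split: if_splits)
  define w where "w = c / a"
  have c: "c = a * w" using a v by (simp add: w_def)
  define z where "z = b / a"
  have b: "b = a * z" using a v by (simp add: z_def)
  have p: "p = (z, Im w / 4)" using assms(2) v a by (auto simp: proj_def z_def w_def)
  have "herm v v = (a * cnj a) * (w + cnj w - 2 * (z * cnj z))"
    by (simp add: herm_def v b c algebra_simps)
  then have "w + cnj w = 2 * (z * cnj z)" using assms(1) a v by simp
  then have "Re w = (cmod z)\<^sup>2" by (simp add: complex_eq_iff cmod_times_cmod power2_eq_square)
  then have "w = Complex ((cmod z)\<^sup>2) (4 * (Im w / 4))" by (simp add: complex_eq_iff)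
  then show "v = cscale (fst v) (lift p)" by (simp add: v b c p cscale_def lift_def)
qed

lemma proj_eq_None:
  assumes "herm v v = 0" "proj v = None"
  shows "v = (0, 0, snd (snd v))"
  using assms by (cases v) (auto simp: proj_def herm_def split: if_splits)

text \<open>The pairing of two lifts is the third coordinate of the lift of
  \<open>hmult (hinv p) q\<close>; its modulus is \<open>sqrt (|z|^4 + 16 u^2)\<close>, the square
  of the Koranyi norm.\<close>

lemma cmod_herm_lift: "cmod (herm (lift p) (lift q)) = (koranyi_dist p q)\<^sup>2"
proof -
  define A where "A = hmult (hinv p) q"
  have h: "herm (lift p) (lift q) = Complex ((cmod (fst A))\<^sup>2) (4 * snd A)"
    by (simp add: A_def herm_def lift_def hmult_def hinv_def complex_eq_iff cmod_times_cmod power2_eq_square field_simps)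
  have "cmod (Complex ((cmod (fst A))\<^sup>2) (4 * snd A)) = sqrt ((cmod (fst A))\<^sup>2 ^ 2 + 16 * (snd A)\<^sup>2)"
    by (simp add: cmod_def power_mult_distrib)
  also have "\<dots> = ((cmod (fst A))\<^sup>2 ^ 2 + 16 * (snd A)\<^sup>2) powr (1/4 + 1/4)"
    by (simp add: powr_half_sqrt)
  also have "\<dots> = (koranyi_norm A)\<^sup>2"
    unfolding koranyi_norm_def by (simp only: powr_add power2_eq_square)
  finally show ?thesis by (simp add: h koranyi_dist_def A_def)
qed

lemma koranyi_dist_nonneg: "koranyi_dist p q \<ge> 0"
  by (simp add: koranyi_dist_def koranyi_norm_def)

lemma koranyi_dist_proj:
  assumes "herm v v = 0" "herm w w = 0" "proj v = Some p" "proj w = Some q"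
  shows "(koranyi_dist p q)\<^sup>2 = cmod (herm v w) / (cmod (fst v) * cmod (fst w))"
proof -
  have "cmod (herm v w) = cmod (fst v) * cmod (fst w) * (koranyi_dist p q)\<^sup>2"
    using proj_eq_Some(2)[OF assms(1,3)] proj_eq_Some(2)[OF assms(2,4)]
    by (metis (no_types) herm_cscale_left herm_cscale_right cmod_herm_lift norm_mult complex_mod_cnj mult.assoc)
  then show ?thesis using proj_eq_Some(1)[OF assms(1,3)] proj_eq_Some(1)[OF assms(2,4)] by simp
qed

lemma herm_lift_eq_0_imp_eq:
  assumes "herm (lift p) (lift q) = 0"
  shows "p = q"
proof -
  obtain z u z' u' where pq: "p = (z, u)" "q = (z', u')" by (cases p, cases q)
  have "Re (herm (lift p) (lift q)) = (cmod (z - z'))\<^sup>2"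
    unfolding pq herm_def lift_def by (simp add: cmod_times_cmod power2_eq_square algebra_simps)
  then have z: "z' = z" using assms by simp
  have "Im (herm (lift p) (lift q)) = 4 * (u' - u)"
    unfolding pq z herm_def lift_def by (simp add: algebra_simps)
  then show ?thesis using assms by (simp add: pq z)
qed

text \<open>In signature (1,2) there is no isotropic plane, so orthogonal null vectors are
  proportional. This yields injectivity of Moebius maps and keeps the denominator of the kernel from
  vanishing off the base point.\<close>

lemma herm_eq_0_iff_proj_eq:
  assumes "herm v v = 0" "herm w w = 0" "v \<noteq> 0" "w \<noteq> 0"
  shows "herm v w = 0 \<longleftrightarrow> proj v = proj w"
proof (cases "proj v"; cases "proj w")
  fix p q assume p: "proj v = Some p" and q: "proj w = Some q"
  have "herm v w = cnj (fst v) * (fst w * herm (lift p) (lift q))"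
    using proj_eq_Some(2)[OF assms(1) p] proj_eq_Some(2)[OF assms(2) q]
    by (metis (no_types) herm_cscale_left herm_cscale_right)
  then show ?thesis
    using p q proj_eq_Some(1)[OF assms(1) p] proj_eq_Some(1)[OF assms(2) q]
      herm_lift_eq_0_imp_eq[of p q] herm_lift_self[of p] by auto
next
  fix q assume p: "proj v = None" and q: "proj w = Some q"
  have "herm v w = cnj (snd (snd v)) * fst w"
    by (subst proj_eq_None[OF assms(1) p]) (simp add: herm_def)
  then show ?thesis using proj_eq_None[OF assms(1) p] assms p q proj_eq_Some(1)[OF assms(2) q]
    by (auto simp: prod_eq_iff zero_prod_def)
next
  fix q assume p: "proj v = Some q" and q: "proj w = None"
  have "herm v w = cnj (fst v) * snd (snd w)"
    by (subst proj_eq_None[OF assms(2) q]) (simp add: herm_def)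
  then show ?thesis using proj_eq_None[OF assms(2) q] assms p q proj_eq_Some(1)[OF assms(1) p]
    by (auto simp: prod_eq_iff zero_prod_def)
next
  assume p: "proj v = None" and q: "proj w = None"
  then show ?thesis using proj_eq_None[OF assms(1) p] proj_eq_None[OF assms(2) q]
    by (simp add: herm_def prod_eq_iff)
qed

text \<open>\<open>bounded_linear\<close> is linearity over the reals; compatibility with
  \<open>cscale\<close> supplies complex homogeneity.\<close>

definition herm_isometry :: "(cvec \<Rightarrow> cvec) \<Rightarrow> bool" where
  "herm_isometry A \<longleftrightarrow> bounded_linear A \<and> (\<forall>k v. A (cscale k v) = cscale k (A v)) \<and>
     (\<forall>v w. herm (A v) (A w) = herm v w)"

lemma herm_isometryD:
  assumes "herm_isometry A"
  shows "bounded_linear A" "A (cscale k v) = cscale k (A v)" "herm (A v) (A w) = herm v w"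
  using assms unfolding herm_isometry_def by blast+

lemma herm_isometry_nonzero:
  assumes "herm_isometry A" "v \<noteq> 0"
  shows "A v \<noteq> 0"
proof
  assume "A v = 0"
  \<comment> \<open>Nondegeneracy of the form: a vector orthogonal to the standard basis is
    0.\<close>
  have h: "herm v w = 0" for w
    using herm_isometryD(3)[OF assms(1), of v w] \<open>A v = 0\<close> by (simp add: herm_def)
  from h[of "(1, 0, 0)"] h[of "(0, 1, 0)"] h[of "(0, 0, 1)"] have "v = 0"
    by (cases v) (simp add: herm_def zero_prod_def)
  with assms show False by simp
qed

lemma herm_isometry_comp: "herm_isometry A \<Longrightarrow> herm_isometry B \<Longrightarrow> herm_isometry (A \<circ> B)"
  unfolding herm_isometry_def o_def by (simp add: bounded_linear_compose del: split_paired_All)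

text \<open>The relation is demanded for all nonzero null vectors, not only for lifts, because
  \<open>B (lift p)\<close> is in general only a multiple of a lift; this makes the notion stable
  under composition.\<close>

definition lin_lift :: "(cvec \<Rightarrow> cvec) \<Rightarrow> (hpt option \<Rightarrow> hpt option) \<Rightarrow> bool" where
  "lin_lift A T \<longleftrightarrow> herm_isometry A \<and> (\<forall>v. v \<noteq> 0 \<longrightarrow> herm v v = 0 \<longrightarrow> proj (A v) = T (proj v))"

lemma lin_liftD:
  assumes "lin_lift A T"
  shows "herm_isometry A" "v \<noteq> 0 \<Longrightarrow> herm v v = 0 \<Longrightarrow> proj (A v) = T (proj v)"
  using assms unfolding lin_lift_def by blast+

lemma lin_lift_id: "lin_lift id id"
  by (simp add: lin_lift_def herm_isometry_def id_def bounded_linear_ident)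

lemma lin_lift_comp:
  assumes "lin_lift A S" "lin_lift B T"
  shows "lin_lift (A \<circ> B) (S \<circ> T)"
  unfolding lin_lift_def
proof (intro conjI allI impI)
  note A = lin_liftD[OF assms(1)] and B = lin_liftD[OF assms(2)]
  show "herm_isometry (A \<circ> B)" by (rule herm_isometry_comp[OF A(1) B(1)])
  fix v :: cvec assume v: "v \<noteq> 0" "herm v v = 0"
  then show "proj ((A \<circ> B) v) = (S \<circ> T) (proj v)"
    using A(2)[OF herm_isometry_nonzero[OF B(1) v(1)]] B(2)[OF v] by (simp add: herm_isometryD(3)[OF B(1)])
qed

section \<open>Linear representatives of the generators\<close>

lemma proj_cscale: "k \<noteq> 0 \<Longrightarrow> proj (cscale k v) = proj v"
  by (simp add: proj_def cscale_def)

text \<open>By homogeneity one representative on each null line is enough: the lifts, and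
  \<open>(0, 0, 1)\<close> for infinity.\<close>

lemma lin_liftI:
  assumes A: "herm_isometry A"
    and fin: "\<And>p. proj (A (lift p)) = T (Some p)"
    and inf: "proj (A (0, 0, 1)) = T None"
  shows "lin_lift A T"
  unfolding lin_lift_def
proof (intro conjI allI impI A)
  fix v :: cvec assume v: "v \<noteq> 0" "herm v v = 0"
  show "proj (A v) = T (proj v)"
  proof (cases "proj v")
    case None
    then have e: "v = cscale (snd (snd v)) (0, 0, 1)" using proj_eq_None[OF v(2)] by (simp add: cscale_def)
    then have "snd (snd v) \<noteq> 0" using v(1) by (metis cscale_def mult_zero_left zero_prod_def)
    then show ?thesis using e inf None by (metis herm_isometryD(2)[OF A] proj_cscale)
  next
    case (Some p)
    then show ?thesis using proj_eq_Some[OF v(2) Some] fin by (metis herm_isometryD(2)[OF A] proj_cscale)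
  qed
qed

text \<open>The obvious matrix \<open>diag (1, l, l^2)\<close> multiplies the form by
  \<open>l^2\<close>; dividing it by \<open>l\<close> gives an isometry with the same projective
  action.\<close>

lemma lin_lift_dilation:
  assumes "l > 0"
  shows "lin_lift (\<lambda>v. (fst v / l, fst (snd v), of_real l * snd (snd v))) (map_option (dilation l))"
proof (rule lin_liftI)
  show "herm_isometry (\<lambda>v. (fst v / l, fst (snd v), of_real l * snd (snd v)))"
    unfolding herm_isometry_def using assms
    by (auto simp: herm_def cscale_def algebra_simps divide_inverse intro!: bounded_linear_intros)
next
  fix p show "proj (fst (lift p) / l, fst (snd (lift p)), of_real l * snd (snd (lift p))) = map_option (dilation l) (Some p)"
    using assms by (simp add: proj_def lift_def dilation_def power2_eq_square mult_ac)
qed (simp add: proj_def)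

lemma lin_lift_rotation:
  "lin_lift (\<lambda>v. (fst v, cis \<theta> * fst (snd v), snd (snd v))) (map_option (rotation \<theta>))"
proof (rule lin_liftI)
  have "cis \<theta> * cnj (cis \<theta>) = 1" by (simp add: cis_cnj cis_mult)
  then have *: "cis \<theta> * (cnj (cis \<theta>) * x) = x" for x by (simp flip: mult.assoc)
  show "herm_isometry (\<lambda>v. (fst v, cis \<theta> * fst (snd v), snd (snd v)))"
    unfolding herm_isometry_def
    by (auto simp: herm_def cscale_def * mult_ac intro!: bounded_linear_intros)
qed (simp_all add: proj_def lift_def rotation_def)

text \<open>The third coordinate of the translated point is linear in the lift because the cross
  terms of the squared modulus and of the group law combine,
  \<open>2 Re (a cnj z) - 2 i Im (a cnj z) = 2 cnj a z\<close>.\<close>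

lemma lin_lift_translation:
  "lin_lift (\<lambda>v. (fst v, fst (snd v) + fst a * fst v,
      snd (snd v) + Complex ((cmod (fst a))\<^sup>2) (4 * snd a) * fst v + 2 * cnj (fst a) * fst (snd v)))
    (map_option (hmult a))"
proof (rule lin_liftI)
  show "herm_isometry (\<lambda>v. (fst v, fst (snd v) + fst a * fst v,
      snd (snd v) + Complex ((cmod (fst a))\<^sup>2) (4 * snd a) * fst v + 2 * cnj (fst a) * fst (snd v)))"
    unfolding herm_isometry_def
    by (auto simp: herm_def cscale_def complex_eq_iff cmod_times_cmod power2_eq_square algebra_simps
      intro!: bounded_linear_intros)
qed (simp_all add: proj_def lift_def hmult_def field_simps)

text \<open>Swapping the outer coordinates exchanges \<open>(1, 0, 0)\<close>, the origin, with
  \<open>(0, 0, 1)\<close>, infinity; renormalizing means dividing by \<open>|z|^2 + 4 i u\<close>,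
  which is the formula for the inversion.\<close>

lemma lin_lift_inversion:
  "lin_lift (\<lambda>v. (snd (snd v), fst (snd v), fst v)) inversion_ext"
proof (rule lin_liftI)
  show "herm_isometry (\<lambda>v. (snd (snd v), fst (snd v), fst v))"
    unfolding herm_isometry_def
    by (auto simp: herm_def cscale_def algebra_simps intro!: bounded_linear_intros)
next
  fix p
  define w where "w = Complex ((cmod (fst p))\<^sup>2) (4 * snd p)"
  have w0: "w = 0 \<longleftrightarrow> p = (0, 0)" by (cases p) (auto simp: w_def complex_eq_iff)
  have w1: "complex_of_real ((cmod (fst p))\<^sup>2) + 4 * \<i> * complex_of_real (snd p) = w"
    by (simp add: w_def complex_eq_iff)
  have w2: "(cmod (fst p)) ^ 4 + 16 * (snd p)\<^sup>2 = (Re w)\<^sup>2 + (Im w)\<^sup>2"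
    by (simp add: w_def power_mult_distrib flip: power_mult)
  define N where "N = (Re w)\<^sup>2 + (Im w)\<^sup>2"
  have "Im w = 4 * snd p" by (simp add: w_def)
  then have "Im (1 / w) = - (4 * snd p) / N"
    by (simp add: Im_divide N_def)
  moreover have "inversion p = (fst p / w, - snd p / N)"
    unfolding inversion_def w1 w2 N_def ..
  ultimately show "proj (snd (snd (lift p)), fst (snd (lift p)), fst (lift p)) = inversion_ext (Some p)"
    using w0 by (simp add: proj_def lift_def inversion_ext_def flip: w_def)
qed (simp add: proj_def inversion_ext_def)

lemma mobius_lin_lift:
  assumes "T \<in> mobius"
  obtains A where "lin_lift A T"
  using assms
proof (induction arbitrary: thesis)
  case (comp S T)
  then show ?case using lin_lift_comp by metis
qed (use lin_lift_dilation lin_lift_rotation lin_lift_translation lin_lift_inversion in blast)+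

text \<open>With \<open>z\<close> the quotient of the second by the first coordinate, the left side
  is \<open>|z'|^2\<close>. The real part of \<open>herm v v' = 0\<close> is tangency to the null
  cone and its imaginary part is the contact condition. The numerator on the right is invariant
  under isometries, so this is how horizontal speed transforms.\<close>

lemma herm_quotient_derivative:
  assumes "herm v v = 0" "herm v v' = 0" "fst v \<noteq> 0"
  shows "(cmod ((fst (snd v') * fst v - fst (snd v) * fst v') / (fst v)\<^sup>2))\<^sup>2 = - Re (herm v' v') / (2 * (cmod (fst v))\<^sup>2)"
proof -
  obtain a b c where v: "v = (a, b, c)" by (cases v)
  obtain a' b' c' where v': "v' = (a', b', c')" by (cases v')
  \<comment> \<open>These two relations eliminate the terms in \<open>2 * (b * cnj b)\<close> and
    \<open>2 * cnj b * b'\<close>, after which the expression factors through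
    \<open>herm v' v'\<close>.\<close>
  have 1: "cnj a * c + cnj c * a = 2 * (b * cnj b)" using assms(1) by (simp add: herm_def v mult_ac)
  have 2: "cnj a * c' + cnj c * a' = 2 * cnj b * b'" using assms(2) by (simp add: herm_def v v')
  have "2 * ((b' * a - b * a') * cnj (b' * a - b * a')) =
      2 * (b' * cnj b') * (a * cnj a) + 2 * (b * cnj b) * (a' * cnj a')
        - (2 * cnj b * b') * (a * cnj a') - cnj (2 * cnj b * b') * (cnj a * a')"
    by (simp add: algebra_simps)
  also have "\<dots> = 2 * (b' * cnj b') * (a * cnj a) + (cnj a * c + cnj c * a) * (a' * cnj a')
        - (cnj a * c' + cnj c * a') * (a * cnj a') - cnj (cnj a * c' + cnj c * a') * (cnj a * a')"
    by (simp only: 1 2)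
  also have "\<dots> = - (a * cnj a) * herm v' v'"
    by (simp add: herm_def v' algebra_simps)
  finally have eq: "2 * ((b' * a - b * a') * cnj (b' * a - b * a')) = - (a * cnj a) * herm v' v'" .
  have "complex_of_real (2 * (cmod (b' * a - b * a'))\<^sup>2) = of_real (- (cmod a)\<^sup>2) * herm v' v'"
    by (simp only: of_real_mult of_real_numeral of_real_minus complex_norm_square eq)
  from arg_cong[OF this, of Re]
  have "2 * (cmod (b' * a - b * a'))\<^sup>2 = - ((cmod a)\<^sup>2) * Re (herm v' v')"
    by simp
  then show ?thesis using assms(3)
    by (simp add: v v' norm_divide norm_power norm_mult power_divide field_simps power2_eq_square)
qed

section \<open>Legendrian curves in the null cone\<close>

lemma isCont_eventually_in_open:
  fixes f :: "'a::t2_space \<Rightarrow> 'b::topological_space"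
  assumes "isCont f x" "open U" "f x \<in> U"
  shows "\<forall>\<^sub>F y in nhds x. f y \<in> U"
  using assms unfolding isCont_def tendsto_at_iff_tendsto_nhds by (auto dest: topological_tendstoD)

text \<open>\<open>Z n\<close> is the \<open>n\<close>-th derivative of the horizontal coordinate
  and \<open>w\<close> stands for \<open>|z|^2 + 4 i u\<close>. The single equation
  \<open>w' = 2 cnj z z'\<close> encodes the derivative of \<open>|z|^2\<close> in its real part and
  the Legendrian condition in its imaginary part. \<open>B\<close> switches between the finite chart
  and the chart at infinity.\<close>

locale null_chart =
  fixes \<gamma> :: "real \<Rightarrow> hpt option" and t e :: real and Z :: "nat \<Rightarrow> real \<Rightarrow> complex"
    and w :: "real \<Rightarrow> complex" and B :: "cvec \<Rightarrow> cvec"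
  assumes e: "e > 0"
    and B: "herm_isometry B"
    and Z_deriv: "s \<in> ball t e \<Longrightarrow> (Z n has_vector_derivative Z (Suc n) s) (at s)"
    and w_deriv: "s \<in> ball t e \<Longrightarrow> (w has_vector_derivative 2 * cnj (Z 0 s) * Z 1 s) (at s)"
    and Re_w: "s \<in> ball t e \<Longrightarrow> Re (w s) = (cmod (Z 0 s))\<^sup>2"
    and regular: "s \<in> ball t e \<Longrightarrow> Z 1 s \<noteq> 0"
    and chart: "s \<in> ball t e \<Longrightarrow> \<gamma> s = proj (B (1, Z 0 s, w s))"
begin

definition v :: "real \<Rightarrow> cvec" where "v s = B (1, Z 0 s, w s)"

lemma center [simp]: "t \<in> ball t e" using e by simp

lemma in_chart: "\<forall>\<^sub>F s in nhds t. s \<in> ball t e"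
  using e by (intro eventually_nhds_in_open) auto

lemma herm_v:
  assumes "s \<in> ball t e"
  shows "herm (v s) (v s) = 0" "v s \<noteq> 0"
proof -
  have "herm (v s) (v s) = herm (1, Z 0 s, w s) (1, Z 0 s, w s)"
    by (simp add: v_def herm_isometryD[OF B])
  also have "\<dots> = 0"
    using Re_w[OF assms] cmod_power2[of "Z 0 s"] by (simp add: herm_def complex_eq_iff power2_eq_square)
  finally show "herm (v s) (v s) = 0" .
  show "v s \<noteq> 0" unfolding v_def by (rule herm_isometry_nonzero[OF B]) (simp add: zero_prod_def)
qed

lemma herm_v_v: "herm (v r) (v s) = w s + cnj (w r) - 2 * cnj (Z 0 r) * Z 0 s"
  by (simp add: v_def herm_isometryD[OF B]) (simp add: herm_def)

lemma v_deriv: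
  assumes "s \<in> ball t e"
  shows "(v has_vector_derivative B (0, Z 1 s, 2 * cnj (Z 0 s) * Z 1 s)) (at s)"
  unfolding v_def
  by (rule bounded_linear.has_vector_derivative[OF herm_isometryD(1)[OF B]])
    (intro has_vector_derivative_Pair has_vector_derivative_const w_deriv[OF assms]
      Z_deriv[OF assms, of 0, unfolded One_nat_def[symmetric]])

lemma v_cont: "isCont v t"
  using v_deriv[OF center] by (rule has_vector_derivative_continuous)

lemma Z_cont: "isCont (Z n) t"
  using Z_deriv[OF center] by (rule has_vector_derivative_continuous)

lemma lift_curve:
  assumes "lin_lift A T" "s \<in> ball t e"
  shows "T (\<gamma> s) = proj (A (v s))"
  using lin_liftD(2)[OF assms(1) herm_v(2,1)[OF assms(2)]] chart[OF assms(2)] by (simp add: v_def)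

text \<open>The tangent vector of the lifted curve has \<open>herm V' V' = - 2 |Z 1|^2\<close>,
  whatever isometries have been applied. Taking the identity for \<open>T\<close> gives the speed of
  \<gamma> itself.\<close>

lemma hspeed_eq:
  assumes A: "lin_lift A T" and s: "s \<in> ball t e" and fin: "fst (A (v s)) \<noteq> 0"
  shows "hspeed (T \<circ> \<gamma>) s = cmod (Z 1 s) / cmod (fst (A (v s)))"
proof -
  have iso: "herm_isometry A" using A by (rule lin_liftD)
  define V V' where "V = (\<lambda>r. A (v r))" and "V' = A (B (0, Z 1 s, 2 * cnj (Z 0 s) * Z 1 s))"
  have V': "(V has_vector_derivative V') (at s)"
    unfolding V_def V'_def by (rule bounded_linear.has_vector_derivative[OF herm_isometryD(1)[OF iso] v_deriv[OF s]])
  note d1 = bounded_linear.has_vector_derivative[OF bounded_linear_fst V']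
  note d2 = bounded_linear.has_vector_derivative[OF bounded_linear_compose[OF bounded_linear_fst bounded_linear_snd] V']
  have inv: "((\<lambda>r. inverse (fst (V r))) has_vector_derivative fst V' * - (inverse (fst (V s)))\<^sup>2) (at s)"
    using field_vector_diff_chain_at[OF d1 DERIV_inverse] fin by (simp add: V_def o_def numeral_2_eq_2)
  have "((\<lambda>r. fst (snd (V r)) / fst (V r)) has_vector_derivative
       (fst (snd V') * fst (V s) - fst (snd (V s)) * fst V') / (fst (V s))\<^sup>2) (at s)"
  proof -
    have "fst (snd (V s)) * (fst V' * - (inverse (fst (V s)))\<^sup>2) + fst (snd V') * inverse (fst (V s))
      = (fst (snd V') * fst (V s) - fst (snd (V s)) * fst V') / (fst (V s))\<^sup>2"
      using fin unfolding V_def by (simp add: field_simps power2_eq_square)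
    then show ?thesis
      using has_vector_derivative_mult[OF d2 inv] unfolding divide_inverse by simp
  qed
  \<comment> \<open>\<open>hspeed\<close> differentiates through \<open>the\<close>, so the quotient
    formula is needed only near \<open>s\<close>, where the first coordinate stays nonzero.\<close>
  moreover have "\<forall>\<^sub>F r in nhds s. fst (snd (V r)) / fst (V r) = fst (the ((T \<circ> \<gamma>) r))"
  proof -
    have "isCont (\<lambda>r. fst (V r)) s" using d1 by (rule has_vector_derivative_continuous)
    then have "\<forall>\<^sub>F r in nhds s. fst (V r) \<noteq> 0"
      using fin open_Compl[OF closed_singleton[of 0]] isCont_eventually_in_open[where f = "\<lambda>r. fst (V r)" and x = s and U = "- {0}"] by (simp add: V_def)
    moreover have "\<forall>\<^sub>F r in nhds s. r \<in> ball t e" using s by (intro eventually_nhds_in_open) auto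
    ultimately show ?thesis
      by eventually_elim (use lift_curve[OF A] in \<open>simp add: V_def proj_def\<close>)
  qed
  ultimately have "((\<lambda>r. fst (the ((T \<circ> \<gamma>) r))) has_vector_derivative
       (fst (snd V') * fst (V s) - fst (snd (V s)) * fst V') / (fst (V s))\<^sup>2) (at s)"
    by (subst has_vector_derivative_cong_ev[where g = "\<lambda>r. fst (snd (V r)) / fst (V r)"])
      (auto elim!: eventually_mono dest: eventually_nhds_x_imp_x)
  then have "hspeed (T \<circ> \<gamma>) s = cmod ((fst (snd V') * fst (V s) - fst (snd (V s)) * fst V') / (fst (V s))\<^sup>2)"
    by (simp add: hspeed_def vector_derivative_at)
  moreover have "(cmod ((fst (snd V') * fst (V s) - fst (snd (V s)) * fst V') / (fst (V s))\<^sup>2))\<^sup>2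
      = (cmod (Z 1 s) / cmod (fst (V s)))\<^sup>2"
  proof (subst herm_quotient_derivative)
    show "herm (V s) (V s) = 0" by (simp add: V_def herm_isometryD[OF iso] herm_v[OF s])
    show "herm (V s) V' = 0"
      by (simp add: V_def V'_def v_def herm_isometryD[OF iso] herm_isometryD[OF B]) (simp add: herm_def)
    have "herm V' V' = - 2 * (cnj (Z 1 s) * Z 1 s)"
      by (simp add: V'_def herm_isometryD[OF iso] herm_isometryD[OF B]) (simp add: herm_def)
    also have "\<dots> = of_real (- 2 * (cmod (Z 1 s))\<^sup>2)"
      by (simp only: complex_norm_square of_real_mult of_real_minus of_real_numeral mult.commute[of "cnj _"])
    finally show "- Re (herm V' V') / (2 * (cmod (fst (V s)))\<^sup>2) = (cmod (Z 1 s) / cmod (fst (V s)))\<^sup>2"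
      by (simp add: power_divide)
  qed (use fin in \<open>simp add: V_def\<close>)
  ultimately show ?thesis by (simp add: V_def)
qed

end

lemma knot_null_chart:
  assumes "legendrian_knot \<gamma>"
  obtains e Z w B where "null_chart \<gamma> t e Z w B"
proof -
  obtain e and c :: "real \<Rightarrow> hpt" where e: "e > 0" and c: "smooth_on (ball t e) c"
      and reg: "\<And>s. s \<in> ball t e \<Longrightarrow> regular_legendrian_at c s"
      and alt: "(\<forall>s\<in>ball t e. \<gamma> s = Some (c s)) \<or> (\<forall>s\<in>ball t e. \<gamma> s = inversion_ext (Some (c s)))"
    using assms unfolding legendrian_knot_def by blast
  obtain D where D: "D 0 = c" "\<And>n s. s \<in> ball t e \<Longrightarrow> (D n has_vector_derivative D (Suc n) s) (at s)"
    using c unfolding smooth_on_def by blast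
  define Z where "Z = (\<lambda>n s. fst (D n s))"
  define w where "w = (\<lambda>s. Complex ((cmod (fst (c s)))\<^sup>2) (4 * snd (c s)))"
  have Z: "(Z n has_vector_derivative Z (Suc n) s) (at s)" if "s \<in> ball t e" for n s
    unfolding Z_def by (rule bounded_linear.has_vector_derivative[OF bounded_linear_fst D(2)[OF that]])
  have leg: "snd (D 1 s) = Im (cnj (Z 0 s) * Z 1 s) / 2" "Z 1 s \<noteq> 0" if s: "s \<in> ball t e" for s
  proof -
    have vd: "vector_derivative c (at s) = D 1 s"
      using D(2)[OF s, of 0] D(1) by (simp add: vector_derivative_at)
    show "snd (D 1 s) = Im (cnj (Z 0 s) * Z 1 s) / 2"
      using reg[OF s] unfolding regular_legendrian_at_def vd Z_def D(1) by blast
    moreover have "D 1 s \<noteq> 0" using reg[OF s] unfolding regular_legendrian_at_def vd by blast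
    \<comment> \<open>If the horizontal component vanished, the Legendrian condition would make the
      vertical one vanish as well.\<close>
    ultimately show "Z 1 s \<noteq> 0" by (auto simp: Z_def prod_eq_iff)
  qed
  have w': "(w has_vector_derivative 2 * cnj (Z 0 s) * Z 1 s) (at s)" if s: "s \<in> ball t e" for s
  proof -
    have u: "((\<lambda>s. snd (c s)) has_vector_derivative snd (D 1 s)) (at s)"
      using bounded_linear.has_vector_derivative[OF bounded_linear_snd D(2)[OF s, of 0]] D(1) by simp
    have w_eq: "w = (\<lambda>s. Z 0 s * cnj (Z 0 s) + of_real (4 * snd (c s)) * \<i>)"
      by (simp add: w_def Z_def D(1) complex_eq_iff fun_eq_iff cmod_times_cmod power2_eq_square)
    have "((\<lambda>s. 4 * snd (c s)) has_vector_derivative 4 * snd (D 1 s)) (at s)"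
      by (rule has_vector_derivative_mult_right[OF u])
    from has_vector_derivative_mult_left[OF bounded_linear.has_vector_derivative[OF bounded_linear_of_real this], of \<i>]
    have i: "((\<lambda>s. complex_of_real (4 * snd (c s)) * \<i>) has_vector_derivative of_real (4 * snd (D 1 s)) * \<i>) (at s)" .
    have "(w has_vector_derivative (Z 0 s * cnj (Z 1 s) + Z 1 s * cnj (Z 0 s)) + of_real (4 * snd (D 1 s)) * \<i>) (at s)"
      unfolding w_eq
      using has_vector_derivative_add[OF has_vector_derivative_mult[OF Z[OF s, of 0]
          bounded_linear.has_vector_derivative[OF bounded_linear_cnj Z[OF s, of 0]]] i] by simp
    also have "(Z 0 s * cnj (Z 1 s) + Z 1 s * cnj (Z 0 s)) + of_real (4 * snd (D 1 s)) * \<i> = 2 * cnj (Z 0 s) * Z 1 s"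
      using leg(1)[OF s] by (simp add: complex_eq_iff algebra_simps)
    finally show ?thesis .
  qed
  have lift: "lift (c s) = (1, Z 0 s, w s)" for s by (simp add: lift_def Z_def w_def D(1))
  have chart: "null_chart \<gamma> t e Z w B" if B: "lin_lift B T" "\<And>s. s \<in> ball t e \<Longrightarrow> \<gamma> s = T (Some (c s))" for B T
  proof
    show "\<gamma> s = proj (B (1, Z 0 s, w s))" if "s \<in> ball t e" for s
    proof -
      have "proj (B (lift (c s))) = T (proj (lift (c s)))"
        by (rule lin_liftD(2)[OF B(1) lift_nonzero herm_lift_self])
      then show ?thesis using B(2)[OF that] unfolding proj_lift by (simp only: lift)
    qed
  qed (use e Z w' leg B in \<open>simp_all add: lin_liftD(1)[OF B(1)] w_def Z_def D(1)\<close>)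
  from alt show ?thesis
  proof
    assume "\<forall>s\<in>ball t e. \<gamma> s = Some (c s)"
    then have "null_chart \<gamma> t e Z w id" by (intro chart[OF lin_lift_id]) simp
    then show ?thesis by (rule that)
  next
    assume "\<forall>s\<in>ball t e. \<gamma> s = inversion_ext (Some (c s))"
    then have "null_chart \<gamma> t e Z w (\<lambda>v. (snd (snd v), fst (snd v), fst v))"
      by (intro chart[OF lin_lift_inversion]) simp
    then show ?thesis by (rule that)
  qed
qed

text \<open>The integrand of the potential in the parameter. In a chart at infinity the kernel has a
  positive limit, so the value 0 creates a removable discontinuity; such parameters are therefore
  treated by boundedness only.\<close>

definition speed_kernel :: "(real \<Rightarrow> hpt option) \<Rightarrow> hpt \<Rightarrow> real \<Rightarrow> real" where
  "speed_kernel \<gamma> p s = (case \<gamma> s of None \<Rightarrow> 0 | Some q \<Rightarrow> hspeed \<gamma> s / (koranyi_dist p q)\<^sup>2)"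

text \<open>The value 1 at infinity is arbitrary; it only keeps the function bounded away from 0.\<close>

definition scaled_dist :: "real \<Rightarrow> (real \<Rightarrow> hpt option) \<Rightarrow> hpt \<Rightarrow> real \<Rightarrow> real" where
  "scaled_dist a \<gamma> p s = (case \<gamma> s of None \<Rightarrow> 1 | Some q \<Rightarrow> a * koranyi_dist p q)"

text \<open>Its reciprocal is the factor by which \<open>T\<close> stretches horizontal lengths at
  \<open>p\<close>.\<close>

abbreviation conf_factor :: "(cvec \<Rightarrow> cvec) \<Rightarrow> hpt \<Rightarrow> real" where
  "conf_factor A p \<equiv> cmod (fst (A (lift p)))"

lemma lin_lift_Some:
  assumes "lin_lift A T" "T (Some p) = Some p'"
  shows "proj (A (lift p)) = Some p'" "herm (A (lift p)) (A (lift p)) = 0" "fst (A (lift p)) \<noteq> 0"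
proof -
  show 1: "proj (A (lift p)) = Some p'"
    using lin_liftD(2)[OF assms(1) lift_nonzero herm_lift_self] assms(2) by simp
  show 2: "herm (A (lift p)) (A (lift p)) = 0"
    by (simp only: herm_isometryD(3)[OF lin_liftD(1)[OF assms(1)]] herm_lift_self)
  show "fst (A (lift p)) \<noteq> 0" by (rule proj_eq_Some(1)[OF 2 1])
qed

lemma proj_surj_on_null: "\<exists>v. v \<noteq> 0 \<and> herm v v = 0 \<and> proj v = P"
proof (cases P)
  case None
  then show ?thesis by (intro exI[of _ "(0, 0, 1)"]) (simp add: herm_def proj_def zero_prod_def)
next
  case (Some p)
  then show ?thesis using lift_nonzero herm_lift_self proj_lift by blast
qed

lemma lin_lift_inj:
  assumes "lin_lift A T"
  shows "inj T"
proof (rule injI)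
  note iso = lin_liftD(1)[OF assms]
  fix P Q assume PQ: "T P = T Q"
  obtain v w where v: "v \<noteq> 0" "herm v v = 0" "proj v = P" and w: "w \<noteq> 0" "herm w w = 0" "proj w = Q"
    using proj_surj_on_null by meson
  have "proj (A v) = proj (A w)" using lin_liftD(2)[OF assms v(1,2)] lin_liftD(2)[OF assms w(1,2)] v w PQ by simp
  moreover have "herm (A v) (A v) = 0" "herm (A w) (A w) = 0" "herm (A v) (A w) = herm v w"
    by (simp_all only: herm_isometryD(3)[OF iso] v w)
  ultimately have "herm v w = 0"
    using herm_eq_0_iff_proj_eq[OF _ _ herm_isometry_nonzero[OF iso v(1)] herm_isometry_nonzero[OF iso w(1)]]
    by simp
  then show "P = Q"
    using herm_eq_0_iff_proj_eq[OF v(2) w(2) v(1) w(1)] v w by simp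
qed

section \<open>Kernel and truncation function in a chart\<close>

lemma eventually_nhds_ball:
  assumes "eventually P (nhds x)"
  shows "\<exists>d>0. \<forall>y\<in>ball x d. P y"
  using assms unfolding eventually_nhds_metric Ball_def mem_ball by (simp add: dist_commute)

context null_chart
begin

lemma dist_eq:
  assumes A: "lin_lift A T" and p: "T (Some p) = Some p'" and s: "s \<in> ball t e" and q: "T (\<gamma> s) = Some q"
  shows "(koranyi_dist p' q)\<^sup>2 = cmod (herm (lift p) (v s)) / (conf_factor A p * cmod (fst (A (v s))))"
    and "fst (A (v s)) \<noteq> 0"
proof -
  note iso = lin_liftD(1)[OF A]
  have V: "herm (A (v s)) (A (v s)) = 0" by (simp add: herm_isometryD(3)[OF iso] herm_v[OF s])
  have q': "proj (A (v s)) = Some q" using lift_curve[OF A s] q by simp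
  show "fst (A (v s)) \<noteq> 0" by (rule proj_eq_Some(1)[OF V q'])
  show "(koranyi_dist p' q)\<^sup>2 = cmod (herm (lift p) (v s)) / (conf_factor A p * cmod (fst (A (v s))))"
    using koranyi_dist_proj[OF lin_lift_Some(2)[OF A p] V lin_lift_Some(1)[OF A p] q']
    by (simp add: herm_isometryD(3)[OF iso])
qed

text \<open>The factor \<open>cmod (fst (A (v s)))\<close> occurs both in the speed and in the
  squared distance and cancels in the quotient; of \<open>A\<close>, only the constant at
  \<open>p\<close> survives.\<close>

lemma speed_kernel_image_eq:
  assumes A: "lin_lift A T" and p: "T (Some p) = Some p'" and s: "s \<in> ball t e"
  shows "speed_kernel (T \<circ> \<gamma>) p' s =
    (if fst (A (v s)) = 0 then 0 else conf_factor A p * (cmod (Z 1 s) / cmod (herm (lift p) (v s))))"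
proof (cases "T (\<gamma> s)")
  case None
  then show ?thesis using lift_curve[OF A s] by (simp add: speed_kernel_def proj_def split: if_splits)
next
  case (Some q)
  note d = dist_eq[OF A p s Some]
  show ?thesis using d(2) lin_lift_Some(3)[OF A p] Some
    by (simp add: speed_kernel_def d(1) hspeed_eq[OF A s d(2)])
qed

lemma speed_kernel_eq:
  assumes "s \<in> ball t e"
  shows "speed_kernel \<gamma> p s = (if fst (v s) = 0 then 0 else cmod (Z 1 s) / cmod (herm (lift p) (v s)))"
  using speed_kernel_image_eq[OF lin_lift_id _ assms, of p p] by simp

text \<open>Unlike in the kernel, the factor \<open>cmod (fst (A (v s)))\<close> remains; its
  variation in \<open>s\<close> is the distortion of the truncation.\<close>

lemma scaled_dist_eq:
  assumes A: "lin_lift A T" and p: "T (Some p) = Some p'" and s: "s \<in> ball t e"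
  shows "scaled_dist (conf_factor A p) (T \<circ> \<gamma>) p' s =
    (if fst (A (v s)) = 0 then 1
     else sqrt (conf_factor A p * cmod (herm (lift p) (v s)) / cmod (fst (A (v s)))))"
proof (cases "T (\<gamma> s)")
  case None
  then show ?thesis using lift_curve[OF A s] by (simp add: scaled_dist_def proj_def split: if_splits)
next
  case (Some q)
  note d = dist_eq[OF A p s Some]
  have "conf_factor A p * koranyi_dist p' q = sqrt ((conf_factor A p * koranyi_dist p' q)\<^sup>2)"
    by (simp add: koranyi_dist_nonneg)
  also have "(conf_factor A p * koranyi_dist p' q)\<^sup>2 = conf_factor A p * cmod (herm (lift p) (v s)) / cmod (fst (A (v s)))"
    using lin_lift_Some(3)[OF A p] unfolding power_mult_distrib d(1) by (simp add: power2_eq_square)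
  finally show ?thesis using Some d(2) by (simp add: scaled_dist_def)
qed

lemma herm_lift_v_cont: "isCont (\<lambda>s. herm (lift p) (v s)) t"
  unfolding herm_def by (intro continuous_intros isCont_fst isCont_snd v_cont)

lemma herm_lift_v_nonzero:
  assumes "\<gamma> t \<noteq> Some p"
  shows "herm (lift p) (v t) \<noteq> 0"
proof -
  have "proj (v t) = \<gamma> t" using chart[OF center] by (simp add: v_def)
  then show ?thesis
    using herm_eq_0_iff_proj_eq[OF herm_lift_self herm_v(1)[OF center] lift_nonzero herm_v(2)[OF center]] assms by simp
qed

lemma fst_image_cont:
  assumes "lin_lift A T"
  shows "isCont (\<lambda>s. fst (A (v s))) t"
  by (intro isCont_fst bounded_linear.isCont[OF herm_isometryD(1)[OF lin_liftD(1)[OF assms]]] v_cont)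

lemma speed_kernel_bounded:
  assumes "\<gamma> t \<noteq> Some p"
  shows "\<exists>M d. d > 0 \<and> (\<forall>s\<in>ball t d. \<bar>speed_kernel \<gamma> p s\<bar> \<le> M)"
proof -
  define k where "k = (\<lambda>s. cmod (Z 1 s) / cmod (herm (lift p) (v s)))"
  have "isCont k t" unfolding k_def
    using herm_lift_v_nonzero[OF assms] by (intro continuous_intros herm_lift_v_cont Z_cont) auto
  then have "\<forall>\<^sub>F s in nhds t. k s \<in> {..<k t + 1}" by (rule isCont_eventually_in_open) auto
  with in_chart have "\<forall>\<^sub>F s in nhds t. \<bar>speed_kernel \<gamma> p s\<bar> \<le> \<bar>k t\<bar> + 1"
  proof eventually_elim
    case (elim s)
    have "k s \<ge> 0" by (simp add: k_def)
    then show ?case using elim speed_kernel_eq[OF elim(1), of p] by (auto simp: k_def)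
  qed
  from eventually_nhds_ball[OF this] show ?thesis by blast
qed

lemma speed_kernel_cont:
  assumes "\<gamma> t \<noteq> Some p" "\<gamma> t \<noteq> None"
  shows "isCont (speed_kernel \<gamma> p) t"
proof -
  define k where "k = (\<lambda>s. cmod (Z 1 s) / cmod (herm (lift p) (v s)))"
  have k: "isCont k t" unfolding k_def
    using herm_lift_v_nonzero[OF assms(1)] by (intro continuous_intros herm_lift_v_cont Z_cont) auto
  have "fst (v t) \<noteq> 0" using chart[OF center] assms(2) by (auto simp: v_def proj_def)
  then have "\<forall>\<^sub>F s in nhds t. fst (v s) \<in> - {0}"
    using fst_image_cont[OF lin_lift_id] by (intro isCont_eventually_in_open open_Compl) auto
  with in_chart have "\<forall>\<^sub>F s in nhds t. speed_kernel \<gamma> p s = k s"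
    by eventually_elim (simp add: speed_kernel_eq k_def)
  from isCont_cong[OF this] k show ?thesis by (rule iffD2)
qed

lemma scaled_dist_lower:
  assumes A: "lin_lift A T" and p: "T (Some p) = Some p'" and "\<gamma> t \<noteq> Some p"
  shows "\<exists>\<eta> d. \<eta> > 0 \<and> d > 0 \<and> (\<forall>s\<in>ball t d. scaled_dist (conf_factor A p) (T \<circ> \<gamma>) p' s \<ge> \<eta>)"
proof -
  define c where "c = cmod (herm (lift p) (v t)) / 2"
  define M where "M = cmod (fst (A (v t))) + 1"
  have c: "c > 0" and M: "M > 0"
    using herm_lift_v_nonzero[OF assms(3)] by (simp_all add: c_def M_def add_nonneg_pos)
  \<comment> \<open>The minimum with 1 covers the default value at infinity; \<open>M\<close> bounds
    the denominator from above, so large values of \<open>h\<close> near infinity do no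
    harm.\<close>
  define \<eta> where "\<eta> = min 1 (sqrt (conf_factor A p * c / M))"
  have \<eta>: "\<eta> > 0" using c M lin_lift_Some(3)[OF A p] by (simp add: \<eta>_def)
  have "isCont (\<lambda>s. cmod (herm (lift p) (v s))) t" by (intro continuous_intros herm_lift_v_cont)
  then have "\<forall>\<^sub>F s in nhds t. cmod (herm (lift p) (v s)) \<in> {c<..}"
    using c by (intro isCont_eventually_in_open) (auto simp: c_def)
  moreover have "isCont (\<lambda>s. cmod (fst (A (v s)))) t" by (intro continuous_intros fst_image_cont[OF A])
  then have "\<forall>\<^sub>F s in nhds t. cmod (fst (A (v s))) \<in> {..<M}"
    by (intro isCont_eventually_in_open) (auto simp: M_def)
  ultimately have "\<forall>\<^sub>F s in nhds t. scaled_dist (conf_factor A p) (T \<circ> \<gamma>) p' s \<ge> \<eta>"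
    using in_chart
  proof eventually_elim
    case (elim s)
    have "sqrt (conf_factor A p * c / M) \<le> sqrt (conf_factor A p * cmod (herm (lift p) (v s)) / cmod (fst (A (v s))))"
      if "fst (A (v s)) \<noteq> 0"
      using elim that c M by (intro real_sqrt_le_mono frac_le mult_left_mono) auto
    then have "\<eta> \<le> sqrt (conf_factor A p * cmod (herm (lift p) (v s)) / cmod (fst (A (v s))))"
      if "fst (A (v s)) \<noteq> 0"
      using that unfolding \<eta>_def by (blast intro: min.coboundedI2)
    then show ?case by (simp add: scaled_dist_eq[OF A p elim(3)]) (simp add: \<eta>_def)
  qed
  from eventually_nhds_ball[OF this] show ?thesis using \<eta> by blast
qed

lemma scaled_dist_cont:
  assumes A: "lin_lift A T" and p: "T (Some p) = Some p'" and fin: "T (\<gamma> t) \<noteq> None"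
  shows "isCont (scaled_dist (conf_factor A p) (T \<circ> \<gamma>) p') t"
proof -
  have V: "fst (A (v t)) \<noteq> 0" using dist_eq(2)[OF A p center] fin by auto
  have k: "isCont (\<lambda>s. sqrt (conf_factor A p * cmod (herm (lift p) (v s)) / cmod (fst (A (v s))))) t"
    using V by (intro continuous_intros herm_lift_v_cont fst_image_cont[OF A]) auto
  have "\<forall>\<^sub>F s in nhds t. fst (A (v s)) \<in> - {0}"
    using V by (intro isCont_eventually_in_open fst_image_cont[OF A] open_Compl) auto
  with in_chart have "\<forall>\<^sub>F s in nhds t. scaled_dist (conf_factor A p) (T \<circ> \<gamma>) p' s
      = sqrt (conf_factor A p * cmod (herm (lift p) (v s)) / cmod (fst (A (v s))))"
    by eventually_elim (simp add: scaled_dist_eq[OF A p])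
  from isCont_cong[OF this] k show ?thesis by (rule iffD2)
qed

end

section \<open>Expansion at the base point\<close>

lemma has_vector_derivative_shift:
  assumes "(f has_vector_derivative f') (at (t + x))"
  shows "((\<lambda>x. f (t + x)) has_vector_derivative f') (at x)"
proof -
  have "((\<lambda>x. t + x) has_vector_derivative 0 + 1) (at x)"
    by (intro has_vector_derivative_add has_vector_derivative_const has_vector_derivative_id)
  from vector_diff_chain_at[OF this assms] show ?thesis by (simp add: o_def)
qed

context null_chart
begin

lemma in_chart_shift: "\<forall>\<^sub>F x in nhds 0. t + x \<in> ball t e"
  using e by (auto simp: eventually_nhds_metric dist_real_def intro!: exI[of _ e])

lemma Z_deriv_shift: "\<forall>\<^sub>F x in nhds 0. ((\<lambda>x. Z n (t + x)) has_vector_derivative Z (Suc n) (t + x)) (at x)"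
  using in_chart_shift by eventually_elim (rule has_vector_derivative_shift, rule Z_deriv)

lemma Z_shift_cont: "isCont (\<lambda>x. Z n (t + x)) 0"
  by (rule isCont_o2[where f = "\<lambda>x. t + x"]) (simp_all add: Z_cont)

lemma jet_Z: "jet (\<lambda>x. Z n (t + x)) (Z n t) (Z (Suc n) t)"
  using jet_of_second_derivative[OF Z_deriv_shift[of n] Z_deriv_shift[of "Suc n"] Z_shift_cont] by simp

lemma w_deriv_shift: "\<forall>\<^sub>F x in nhds 0. ((\<lambda>x. w (t + x)) has_vector_derivative 2 * cnj (Z 0 (t + x)) * Z 1 (t + x)) (at x)"
  using in_chart_shift by eventually_elim (rule has_vector_derivative_shift, rule w_deriv)

lemma jet_w: "jet (\<lambda>x. w (t + x)) (w t) (2 * cnj (Z 0 t) * Z 1 t)"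
proof -
  have "\<forall>\<^sub>F x in nhds 0. ((\<lambda>x. 2 * cnj (Z 0 (t + x)) * Z 1 (t + x)) has_vector_derivative
      2 * cnj (Z 0 (t + x)) * Z 2 (t + x) + 2 * cnj (Z 1 (t + x)) * Z 1 (t + x)) (at x)"
    using Z_deriv_shift[of 0] Z_deriv_shift[of 1]
  proof eventually_elim
    case (elim x)
    show ?case
      using has_vector_derivative_mult[OF has_vector_derivative_mult_right[OF
          bounded_linear.has_vector_derivative[OF bounded_linear_cnj elim(1)], of 2] elim(2)]
      by (simp add: numeral_2_eq_2)
  qed
  from jet_of_second_derivative[OF w_deriv_shift this] show ?thesis
    by (simp add: continuous_intros Z_shift_cont)
qed

lemma jet_image:
  assumes "bounded_linear A"
  shows "\<exists>b. jet (\<lambda>x. A (v (t + x))) (A (v t)) b"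
  using jet_bounded_linear[OF jet_Pair[OF jet_const[of 1] jet_Pair[OF jet_Z[of 0] jet_w]]
      bounded_linear_compose[OF assms herm_isometryD(1)[OF B]]]
  by (auto simp: v_def)

text \<open>As a function of the second parameter the pairing has derivative
  \<open>2 cnj (z s - z t) z' s\<close>, which itself vanishes at \<open>t\<close>. Two integrations
  turn the jet of \<open>z'\<close> into that of the pairing divided by \<open>x^2\<close>.\<close>

lemma jet_herm:
  "jet (\<lambda>x. cmod (herm (v t) (v (t + x))) / x\<^sup>2) ((cmod (Z 1 t))\<^sup>2) (Re (cnj (Z 1 t) * Z 2 t))"
proof -
  define G where "G = (\<lambda>x. herm (v t) (v (t + x)))"
  define a where "a = Z 1 t"
  define b where "b = Z 2 t"
  have a: "a \<noteq> 0" using regular[OF center] by (simp add: a_def)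
  have j1: "jet (\<lambda>x. Z 1 (t + x)) a b" using jet_Z[of 1] by (simp add: a_def b_def numeral_2_eq_2)
  have d0: "\<forall>\<^sub>F x in nhds 0. ((\<lambda>x. Z 0 (t + x) - Z 0 t) has_vector_derivative Z 1 (t + x)) (at x)"
    using Z_deriv_shift[of 0] by eventually_elim (auto intro!: derivative_eq_intros)
  have "jet (\<lambda>x. (1 / x ^ Suc 0) *\<^sub>R (Z 0 (t + x) - Z 0 t)) (a /\<^sub>R real (0 + 1)) (b /\<^sub>R real (0 + 2))"
    by (rule jet_integrate[OF d0]) (use j1 in simp_all)
  then have j0: "jet (\<lambda>x. (1 / x) *\<^sub>R (Z 0 (t + x) - Z 0 t)) a (b /\<^sub>R 2)" by simp
  have "jet (\<lambda>x. (2 * cnj ((1 / x) *\<^sub>R (Z 0 (t + x) - Z 0 t))) * Z 1 (t + x))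
     (2 * cnj a * a) (2 * cnj a * b + 2 * cnj (b /\<^sub>R 2) * a)"
    using jet_mult[OF jet_mult[OF jet_const[of 2] jet_bounded_linear[OF j0 bounded_linear_cnj]] j1] by simp
  then have j: "jet (\<lambda>x. (1 / x ^ 1) *\<^sub>R (2 * cnj (Z 0 (t + x) - Z 0 t) * Z 1 (t + x)))
     (2 * cnj a * a) (2 * cnj a * b + cnj b * a)"
    by (simp add: scaleR_conv_of_real mult_ac)
  have G_eq: "G = (\<lambda>x. w (t + x) + cnj (w t) - 2 * cnj (Z 0 t) * Z 0 (t + x))"
    by (simp add: G_def herm_v_v)
  have dG: "\<forall>\<^sub>F x in nhds 0. (G has_vector_derivative 2 * cnj (Z 0 (t + x) - Z 0 t) * Z 1 (t + x)) (at x)"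
    using w_deriv_shift Z_deriv_shift[of 0]
  proof eventually_elim
    case (elim x)
    have "((\<lambda>x. w (t + x) + cnj (w t) - 2 * cnj (Z 0 t) * Z 0 (t + x)) has_vector_derivative
        2 * cnj (Z 0 (t + x)) * Z 1 (t + x) + 0 - 2 * cnj (Z 0 t) * Z (Suc 0) (t + x)) (at x)"
      by (intro has_vector_derivative_add has_vector_derivative_diff elim has_vector_derivative_const
        has_vector_derivative_mult_right)
    then show ?case by (simp add: G_eq algebra_simps)
  qed
  have "G 0 = 0" using herm_v(1)[OF center] by (simp add: G_def)
  from jet_integrate[OF dG j this]
  have "jet (\<lambda>x. (1 / x\<^sup>2) *\<^sub>R G x) ((2 * cnj a * a) /\<^sub>R 2) ((2 * cnj a * b + cnj b * a) /\<^sub>R 3)"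
    by (simp add: numeral_2_eq_2)
  moreover have "(2 * cnj a * a) /\<^sub>R 2 = of_real ((cmod a)\<^sup>2)"
    by (simp add: scaleR_conv_of_real mult_ac flip: complex_norm_square)
  ultimately have "jet (\<lambda>x. (1 / x\<^sup>2) *\<^sub>R G x) (of_real ((cmod a)\<^sup>2)) ((2 * cnj a * b + cnj b * a) /\<^sub>R 3)"
    by simp
  \<comment> \<open>The leading coefficient is real and positive, so the modulus picks out the real
    part of the next one, where the weights \<open>2/3\<close> and \<open>1/3\<close> add up to
    1.\<close>
  from jet_cmod[OF this]
  have "jet (\<lambda>x. cmod (G x) / x\<^sup>2) ((cmod a)\<^sup>2)
      (Re (cnj (of_real ((cmod a)\<^sup>2)) * ((2 * cnj a * b + cnj b * a) /\<^sub>R 3)) / (cmod a)\<^sup>2)"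
    using a by (simp add: norm_power)
  moreover have "Re (cnj (of_real ((cmod a)\<^sup>2)) * ((2 * cnj a * b + cnj b * a) /\<^sub>R 3)) / (cmod a)\<^sup>2 = Re (cnj a * b)"
  proof -
    have "Re (cnj (of_real ((cmod a)\<^sup>2)) * ((2 * cnj a * b + cnj b * a) /\<^sub>R 3))
        = (cmod a)\<^sup>2 * Re ((2 * cnj a * b + cnj b * a) /\<^sub>R 3)"
      by (simp only: complex_cnj_complex_of_real Re_complex_of_real Im_complex_of_real times_complex.sel mult_zero_left diff_zero)
    moreover have "Re ((2 * cnj a * b + cnj b * a) /\<^sub>R 3) = Re (cnj a * b)" by (simp add: field_simps)
    ultimately show ?thesis using a by simp
  qed
  ultimately show ?thesis by (simp only: G_def a_def b_def)
qed

text \<open>Both \<open>cmod (Z 1 s)\<close> and \<open>cmod (herm (v t) (v s)) / (s - t)\<^sup>2\<close> have the same logarithmic derivative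
  at \<open>t\<close>, so the pole of their quotient has no first-order correction.\<close>

lemma jet_kernel:
  "jet (\<lambda>x. cmod (Z 1 (t + x)) * (1 / (cmod (herm (v t) (v (t + x))) / x\<^sup>2))) (1 / cmod (Z 1 t)) 0"
proof -
  define m where "m = cmod (Z 1 t)"
  define r where "r = Re (cnj (Z 1 t) * Z 2 t)"
  have m: "m > 0" using regular[OF center] by (simp add: m_def)
  have "jet (\<lambda>x. cmod (Z 1 (t + x))) m (r / m)"
    using jet_cmod[OF jet_Z[of 1] regular[OF center]] by (simp add: m_def r_def numeral_2_eq_2)
  moreover have "jet (\<lambda>x. 1 / (cmod (herm (v t) (v (t + x))) / x\<^sup>2)) (1 / m\<^sup>2) (- r / (m\<^sup>2)\<^sup>2)"
    using jet_inverse[OF jet_herm] m by (simp add: m_def r_def)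
  ultimately have "jet (\<lambda>x. cmod (Z 1 (t + x)) * (1 / (cmod (herm (v t) (v (t + x))) / x\<^sup>2)))
      (m * (1 / m\<^sup>2)) (m * (- r / (m\<^sup>2)\<^sup>2) + r / m * (1 / m\<^sup>2))"
    by (rule jet_mult)
  moreover have "m * (1 / m\<^sup>2) = 1 / m" "m * (- r / (m\<^sup>2)\<^sup>2) + r / m * (1 / m\<^sup>2) = 0"
    using m by (simp_all add: field_simps power2_eq_square)
  ultimately show ?thesis by (simp add: m_def)
qed

lemma herm_base:
  assumes "\<gamma> t = Some p"
  shows "fst (v t) \<noteq> 0" "v t = cscale (fst (v t)) (lift p)"
    "cmod (herm (lift p) (v s)) = cmod (herm (v t) (v s)) / cmod (fst (v t))"
proof -
  have "proj (v t) = Some p" using chart[OF center] assms by (simp add: v_def)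
  note * = proj_eq_Some[OF herm_v(1)[OF center] this]
  show 1: "fst (v t) \<noteq> 0" and 2: "v t = cscale (fst (v t)) (lift p)" by (fact *)+
  have "cmod (herm (v t) (v s)) = cmod (fst (v t)) * cmod (herm (lift p) (v s))"
    by (subst 2) (simp add: herm_cscale_left norm_mult)
  then show "cmod (herm (lift p) (v s)) = cmod (herm (v t) (v s)) / cmod (fst (v t))"
    using 1 by simp
qed

lemma hspeed_base:
  assumes "\<gamma> t = Some p" and A: "lin_lift A T" and "T (Some p) = Some p'"
  shows "hspeed \<gamma> t = cmod (Z 1 t) / cmod (fst (v t))"
    and "hspeed (T \<circ> \<gamma>) t = hspeed \<gamma> t / conf_factor A p"
    and "cmod (fst (A (v t))) = cmod (fst (v t)) * conf_factor A p"
proof -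
  note b = herm_base[OF assms(1)]
  show 1: "hspeed \<gamma> t = cmod (Z 1 t) / cmod (fst (v t))"
    using hspeed_eq[OF lin_lift_id center] b(1) by simp
  show 2: "cmod (fst (A (v t))) = cmod (fst (v t)) * conf_factor A p"
    by (subst b(2)) (simp add: herm_isometryD(2)[OF lin_liftD(1)[OF A]] norm_mult)
  then have "fst (A (v t)) \<noteq> 0" using b(1) lin_lift_Some(3)[OF A assms(3)] by auto
  from hspeed_eq[OF A center this]
  show "hspeed (T \<circ> \<gamma>) t = hspeed \<gamma> t / conf_factor A p" by (simp add: 1 2)
qed

lemma eventually_shift:
  assumes "\<forall>\<^sub>F x in at 0. P (t + x)"
  shows "\<exists>d>0. \<forall>s. 0 < \<bar>s - t\<bar> \<and> \<bar>s - t\<bar> < d \<longrightarrow> P s"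
proof -
  obtain d where d: "d > 0" "\<And>x. x \<noteq> 0 \<Longrightarrow> dist x 0 < d \<Longrightarrow> P (t + x)"
    using assms unfolding eventually_at by blast
  have "P s" if "0 < \<bar>s - t\<bar>" "\<bar>s - t\<bar> < d" for s
    using d(2)[of "s - t"] that by simp
  then show ?thesis using d(1) by blast
qed

text \<open>The kernel is \<open>\<beta> / x^2\<close> times the function of
  \<open>jet_kernel\<close>, where \<beta> accounts for replacing \<open>v t\<close> by
  \<open>lift p\<close>. Since that jet has linear coefficient 0, only a bounded error is
  left.\<close>

lemma speed_kernel_expansion:
  assumes p: "\<gamma> t = Some p"
  shows "\<exists>K \<delta>. \<delta> > 0 \<and> (\<forall>s. 0 < \<bar>s - t\<bar> \<and> \<bar>s - t\<bar> < \<delta> \<longrightarrow>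
    \<bar>speed_kernel \<gamma> p s - 1 / (hspeed \<gamma> t * (s - t)\<^sup>2)\<bar> \<le> K)"
proof -
  note b = herm_base[OF p]
  define \<beta> where "\<beta> = cmod (fst (v t))"
  have \<beta>: "\<beta> > 0" using b(1) by (simp add: \<beta>_def)
  have sp: "hspeed \<gamma> t = cmod (Z 1 t) / \<beta>"
    using hspeed_base(1)[OF p lin_lift_id] by (simp add: \<beta>_def)
  obtain K where "K \<ge> 0" and K: "\<forall>\<^sub>F x in at 0. norm (cmod (Z 1 (t + x)) * (1 / (cmod (herm (v t) (v (t + x))) / x\<^sup>2))
      - 1 / cmod (Z 1 t) - x *\<^sub>R 0) \<le> K * x\<^sup>2"
    using jet_kernel by (rule jetE)
  have "\<forall>\<^sub>F s in nhds t. fst (v s) \<in> - {0}"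
    using fst_image_cont[OF lin_lift_id] b(1) by (intro isCont_eventually_in_open open_Compl) auto
  then have ne: "\<forall>\<^sub>F x in at 0. fst (v (t + x)) \<noteq> 0"
    unfolding eventually_nhds_metric eventually_at by (auto simp: dist_real_def)
  have ch: "\<forall>\<^sub>F x in at 0. t + x \<in> ball t e"
    using in_chart_shift by (simp add: eventually_at_filter eventually_mono)
  have "\<forall>\<^sub>F x in at 0. \<bar>speed_kernel \<gamma> p (t + x) - 1 / (hspeed \<gamma> t * ((t + x) - t)\<^sup>2)\<bar> \<le> \<beta> * K"
    using K ne ch eventually_small_at_0
  proof eventually_elim
    case (elim x)
    have x2: "x\<^sup>2 > 0" using elim by simp
    have "speed_kernel \<gamma> p (t + x) - 1 / (hspeed \<gamma> t * x\<^sup>2)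
       = \<beta> / x\<^sup>2 * (cmod (Z 1 (t + x)) * (1 / (cmod (herm (v t) (v (t + x))) / x\<^sup>2)) - 1 / cmod (Z 1 t))"
      using elim x2 \<beta> unfolding speed_kernel_eq[OF elim(3)] sp b(3) \<beta>_def[symmetric]
      by (simp add: right_diff_distrib mult.commute)
    also have "\<bar>\<dots>\<bar> \<le> \<beta> / x\<^sup>2 * (K * x\<^sup>2)"
      unfolding abs_mult using elim \<beta> by (intro mult_mono) auto
    finally show ?case using x2 by simp
  qed
  from eventually_shift[OF this] show ?thesis by blast
qed

text \<open>Scaling by \<open>conf_factor A p\<close> makes the leading coefficient
  \<open>hspeed \<gamma> t\<close>, the same as in the pole of the kernel, for every
  \<open>T\<close>; the dependence on \<open>T\<close> moves into \<open>a\<close>.\<close>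

lemma scaled_dist_expansion:
  assumes p: "\<gamma> t = Some p" and A: "lin_lift A T" and p': "T (Some p) = Some p'"
  shows "\<exists>K a \<delta>. \<delta> > 0 \<and> (\<forall>s. 0 < \<bar>s - t\<bar> \<and> \<bar>s - t\<bar> < \<delta> \<longrightarrow>
     scaled_dist (conf_factor A p) (T \<circ> \<gamma>) p' s > 0 \<and>
     \<bar>1 / scaled_dist (conf_factor A p) (T \<circ> \<gamma>) p' s - 1 / (hspeed \<gamma> t * \<bar>s - t\<bar>) + a * sgn (s - t)\<bar> \<le> K * \<bar>s - t\<bar>)"
proof -
  note b = herm_base[OF p]
  define \<beta> where "\<beta> = cmod (fst (v t))"
  define c where "c = conf_factor A p"
  define h where "h = scaled_dist (conf_factor A p) (T \<circ> \<gamma>) p'"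
  have \<beta>: "\<beta> > 0" using b(1) by (simp add: \<beta>_def)
  have c: "c > 0" using lin_lift_Some(3)[OF A p'] by (simp add: c_def)
  have m: "cmod (Z 1 t) > 0" using regular[OF center] by simp
  have sp: "hspeed \<gamma> t = cmod (Z 1 t) / \<beta>"
    using hspeed_base(1)[OF p lin_lift_id] by (simp add: \<beta>_def)
  have At: "cmod (fst (A (v t))) = \<beta> * c" using hspeed_base(3)[OF p A p'] by (simp add: \<beta>_def c_def)
  obtain b1 where "jet (\<lambda>x. fst (A (v (t + x)))) (fst (A (v t))) b1"
    using jet_image[OF bounded_linear_compose[OF bounded_linear_fst herm_isometryD(1)[OF lin_liftD(1)[OF A]]]] by blast
  from jet_cmod[OF this] obtain b2 where j1: "jet (\<lambda>x. cmod (fst (A (v (t + x))))) (\<beta> * c) b2"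
    using At \<beta> c by fastforce
  have j2: "jet (\<lambda>x. 1 / (cmod (herm (v t) (v (t + x))) / x\<^sup>2)) (1 / (cmod (Z 1 t))\<^sup>2)
      (- Re (cnj (Z 1 t) * Z 2 t) / ((cmod (Z 1 t))\<^sup>2)\<^sup>2)"
    using jet_inverse[OF jet_herm] m by simp
  \<comment> \<open>\<open>E x\<close> equals \<open>|x| / h (t + x)\<close> for small
    \<open>x \<noteq> 0\<close> and has a jet at 0. Dividing it by \<open>|x|\<close> expands
    \<open>1 / h\<close>, and the linear term becomes \<open>b4 * sgn x\<close>, the source of the
    opposite signs on the two sides.\<close>
  define E where "E = (\<lambda>x. sqrt (\<beta> / c * (cmod (fst (A (v (t + x)))) * (1 / (cmod (herm (v t) (v (t + x))) / x\<^sup>2)))))"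
  obtain b3 where "jet (\<lambda>x. \<beta> / c * (cmod (fst (A (v (t + x)))) * (1 / (cmod (herm (v t) (v (t + x))) / x\<^sup>2))))
     (\<beta> / c * (\<beta> * c * (1 / (cmod (Z 1 t))\<^sup>2))) b3"
    using jet_mult[OF jet_const jet_mult[OF j1 j2]] by blast
  from jet_sqrt[OF this] obtain b4 where "jet E (sqrt (\<beta> / c * (\<beta> * c * (1 / (cmod (Z 1 t))\<^sup>2)))) b4"
    using \<beta> c m by (fastforce simp: E_def)
  moreover have "\<beta> / c * (\<beta> * c * (1 / (cmod (Z 1 t))\<^sup>2)) = (1 / hspeed \<gamma> t)\<^sup>2"
    using c \<beta> m by (simp add: sp power_divide power2_eq_square)
  moreover have "1 / hspeed \<gamma> t > 0" using \<beta> m by (simp add: sp)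
  ultimately have "jet E (1 / hspeed \<gamma> t) b4" by simp
  then obtain K where "K \<ge> 0" and K: "\<forall>\<^sub>F x in at 0. norm (E x - 1 / hspeed \<gamma> t - x *\<^sub>R b4) \<le> K * x\<^sup>2"
    by (rule jetE)
  have "fst (A (v t)) \<noteq> 0" using At \<beta> c by auto
  then have "\<forall>\<^sub>F s in nhds t. fst (A (v s)) \<in> - {0}"
    using fst_image_cont[OF A] by (intro isCont_eventually_in_open open_Compl) auto
  then have ne: "\<forall>\<^sub>F x in at 0. fst (A (v (t + x))) \<noteq> 0"
    unfolding eventually_nhds_metric eventually_at by (auto simp: dist_real_def)
  have pos: "\<forall>\<^sub>F x in at 0. 0 < cmod (herm (v t) (v (t + x))) / x\<^sup>2"
    using jet_tendsto[OF jet_herm] m by (intro order_tendstoD) auto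
  have ch: "\<forall>\<^sub>F x in at 0. t + x \<in> ball t e"
    using in_chart_shift by (simp add: eventually_at_filter eventually_mono)
  have "\<forall>\<^sub>F x in at 0. h (t + x) > 0 \<and>
     \<bar>1 / h (t + x) - 1 / (hspeed \<gamma> t * \<bar>(t + x) - t\<bar>) + (- b4) * sgn ((t + x) - t)\<bar> \<le> K * \<bar>(t + x) - t\<bar>"
    using K ne pos ch eventually_small_at_0
  proof eventually_elim
    case (elim x)
    define g where "g = cmod (herm (v t) (v (t + x))) / x\<^sup>2"
    define q where "q = cmod (fst (A (v (t + x))))"
    have x: "\<bar>x\<bar> > 0" and g: "g > 0" and q: "q > 0" using elim by (simp_all add: g_def q_def)
    have "h (t + x) = sqrt (c * (cmod (herm (v t) (v (t + x))) / \<beta>) / q)"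
      using elim unfolding h_def scaled_dist_eq[OF A p' elim(4)] b(3) by (simp add: c_def \<beta>_def q_def)
    also have "c * (cmod (herm (v t) (v (t + x))) / \<beta>) / q = x\<^sup>2 * (1 / (\<beta> / c * (q * (1 / g))))"
      using x c \<beta> q g by (simp add: g_def field_simps)
    also have "sqrt \<dots> = \<bar>x\<bar> / E x"
      by (simp add: real_sqrt_mult real_sqrt_divide E_def g_def q_def)
    finally have h: "h (t + x) = \<bar>x\<bar> / E x" .
    have E: "E x > 0" using c \<beta> q g unfolding E_def g_def[symmetric] q_def[symmetric] by simp
    have "1 / h (t + x) - 1 / (hspeed \<gamma> t * \<bar>x\<bar>) + (- b4) * sgn x = (E x - 1 / hspeed \<gamma> t - x * b4) / \<bar>x\<bar>"
      using x by (simp add: h real_sgn_eq diff_divide_distrib mult.commute)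
    then have "\<bar>1 / h (t + x) - 1 / (hspeed \<gamma> t * \<bar>x\<bar>) + (- b4) * sgn x\<bar> = \<bar>E x - 1 / hspeed \<gamma> t - x * b4\<bar> / \<bar>x\<bar>"
      by simp
    also have "\<dots> \<le> K * x\<^sup>2 / \<bar>x\<bar>" using elim x by (intro divide_right_mono) auto
    also have "\<dots> = K * \<bar>x\<bar>" using x by (simp add: power2_eq_square abs_if)
    finally show ?case using h E x by simp
  qed
  from eventually_shift[OF this] show ?thesis unfolding h_def by blast
qed

end

section \<open>Invariance of the energy\<close>

text \<open>A Hadamard finite part: the pole is subtracted under the integral, and the boundary
  terms are the finite part of the integral of the pole over the unit interval.\<close>

definition renormalized_potential :: "(real \<Rightarrow> hpt option) \<Rightarrow> hpt \<Rightarrow> real \<Rightarrow> real" where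
  "renormalized_potential \<gamma> p t =
    (\<integral>s. (speed_kernel \<gamma> p s - 1 / (hspeed \<gamma> t * (s - t)\<^sup>2)) * indicator {0<..<1} s \<partial>lborel)
      - 1 / (hspeed \<gamma> t * t) - 1 / (hspeed \<gamma> t * (1 - t))"

text \<open>Injectivity over one period leaves at most one such parameter.\<close>

lemma knot_finite_infinities:
  assumes "legendrian_knot \<gamma>" "inj T"
  shows "finite {s \<in> {0..<1}. T (\<gamma> s) = None}"
proof (rule finite_subset)
  let ?Y = "{s \<in> {0..<1}. T (\<gamma> s) = None}"
  have "inj_on (T \<circ> \<gamma>) {0..<1}"
    using assms by (intro comp_inj_on) (auto simp: legendrian_knot_def intro: inj_on_subset)
  then have "s = r" if "s \<in> ?Y" "r \<in> ?Y" for s r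
    using that by (auto dest!: inj_onD[of _ _ s r])
  then show "?Y \<subseteq> {SOME s. s \<in> ?Y}" by (metis (mono_tags, lifting) singletonI someI subsetI)
qed simp

text \<open>The transformation enters the right side only through a constant factor. For the
  identity this factor is 1, so the same statement evaluates the potential of \<gamma>.\<close>

lemma Vpot_mobius:
  assumes K: "legendrian_knot \<gamma>" and t: "0 < t" "t < 1" and p: "\<gamma> t = Some p"
    and A: "lin_lift A T" and p': "T (Some p) = Some p'"
  shows "Vpot (T \<circ> \<gamma>) p' = conf_factor A p * renormalized_potential \<gamma> p t"
proof -
  define a where "a = conf_factor A p"
  have a: "a > 0" using lin_lift_Some(3)[OF A p'] by (simp add: a_def)
  define h where "h = scaled_dist a (T \<circ> \<gamma>) p'"
  define X where "X = {s \<in> {0..<1}. \<gamma> s = None} \<union> {s \<in> {0..<1}. T (\<gamma> s) = None}"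
  have X: "finite X"
    unfolding X_def using knot_finite_infinities[OF K lin_lift_inj[OF lin_lift_id]]
      knot_finite_infinities[OF K lin_lift_inj[OF A]] by simp
  \<comment> \<open>The end point 1 is included because the local bounds are needed on a compact
    interval; there periodicity reduces to the parameter 0.\<close>
  have ne: "\<gamma> s \<noteq> Some p" if "s \<in> {0..1} - {t}" for s
  proof -
    have inj: "inj_on \<gamma> {0..<1}" and per: "\<gamma> 1 = \<gamma> 0"
      using K by (auto simp: legendrian_knot_def dest: spec[of _ 0])
    have "\<gamma> s \<noteq> \<gamma> t"
    proof (cases "s = 1")
      case True
      then show ?thesis using inj_onD[OF inj, of 0 t] per t by auto
    next
      case False
      then show ?thesis using inj_onD[OF inj, of s t] that t by auto
    qed
    then show ?thesis by (simp add: p)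
  qed
  have v: "hspeed \<gamma> t > 0"
  proof -
    obtain e Z w B where "null_chart \<gamma> t e Z w B" using knot_null_chart[OF K] by blast
    then interpret null_chart \<gamma> t e Z w B .
    show ?thesis using hspeed_base(1)[OF p A p'] herm_base(1)[OF p] regular[OF center] by simp
  qed
  have lim: "((\<lambda>\<epsilon>. (\<integral>s. speed_kernel \<gamma> p s * indicator {s \<in> {0<..<1}. h s \<ge> \<epsilon>} s \<partial>lborel) - 2 / \<epsilon>)
      \<longlongrightarrow> renormalized_potential \<gamma> p t) (at_right 0)"
    unfolding renormalized_potential_def
  proof (rule principal_part_regularization[OF t v countable_finite[OF X]])
    fix s assume s: "s \<in> {0<..<1} - {t} - X"
    obtain e Z w B where "null_chart \<gamma> s e Z w B" using knot_null_chart[OF K] by blast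
    then interpret null_chart \<gamma> s e Z w B .
    show "isCont (speed_kernel \<gamma> p) s" using s ne[of s] by (intro speed_kernel_cont) (auto simp: X_def)
    show "isCont h s" unfolding h_def a_def using s by (intro scaled_dist_cont[OF A p']) (auto simp: X_def)
  next
    fix s assume s: "s \<in> {0..1} - {t}"
    obtain e Z w B where "null_chart \<gamma> s e Z w B" using knot_null_chart[OF K] by blast
    then interpret null_chart \<gamma> s e Z w B .
    show "\<exists>M d. d > 0 \<and> (\<forall>r\<in>ball s d. \<bar>speed_kernel \<gamma> p r\<bar> \<le> M)"
      by (rule speed_kernel_bounded[OF ne[OF s]])
    show "\<exists>\<eta> d. \<eta> > 0 \<and> d > 0 \<and> (\<forall>r\<in>ball s d. h r \<ge> \<eta>)"
      unfolding h_def a_def by (rule scaled_dist_lower[OF A p' ne[OF s]])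
  next
    obtain e Z w B where "null_chart \<gamma> t e Z w B" using knot_null_chart[OF K] by blast
    then interpret null_chart \<gamma> t e Z w B .
    show "\<exists>K \<delta>. \<delta> > 0 \<and> (\<forall>s. 0 < \<bar>s - t\<bar> \<and> \<bar>s - t\<bar> < \<delta> \<longrightarrow>
        \<bar>speed_kernel \<gamma> p s - 1 / (hspeed \<gamma> t * (s - t)\<^sup>2)\<bar> \<le> K)"
      by (rule speed_kernel_expansion[OF p])
    show "\<exists>K a \<delta>. \<delta> > 0 \<and> (\<forall>s. 0 < \<bar>s - t\<bar> \<and> \<bar>s - t\<bar> < \<delta> \<longrightarrow> h s > 0 \<and>
        \<bar>1 / h s - 1 / (hspeed \<gamma> t * \<bar>s - t\<bar>) + a * sgn (s - t)\<bar> \<le> K * \<bar>s - t\<bar>)"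
      unfolding h_def a_def by (rule scaled_dist_expansion[OF p A p'])
  qed
  \<comment> \<open>The integrands agree off \<open>X\<close> and 0; the parameter 0 is dropped
    because the limit statement works on the open interval.\<close>
  have arc: "arc_integral (T \<circ> \<gamma>) {q. koranyi_dist p' q \<ge> \<epsilon>} (\<lambda>q. 1 / (koranyi_dist p' q)\<^sup>2)
      = a * (\<integral>s. speed_kernel \<gamma> p s * indicator {s \<in> {0<..<1}. h s \<ge> a * \<epsilon>} s \<partial>lborel)" for \<epsilon>
  proof -
    have "arc_integral (T \<circ> \<gamma>) {q. koranyi_dist p' q \<ge> \<epsilon>} (\<lambda>q. 1 / (koranyi_dist p' q)\<^sup>2)
      = (\<integral>s. a * (speed_kernel \<gamma> p s * indicator {s \<in> {0<..<1}. h s \<ge> a * \<epsilon>} s) \<partial>lborel)"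
      unfolding arc_integral_def set_lebesgue_integral_def
    proof (rule integral_discrete_difference[where X = "X \<union> {0}"])
      show "countable (X \<union> {0})" using X by (simp add: countable_finite)
      fix s assume s: "s \<notin> X \<union> {0}"
      show "indicator {0..<1} s *\<^sub>R (case (T \<circ> \<gamma>) s of None \<Rightarrow> 0
            | Some q \<Rightarrow> if q \<in> {q. \<epsilon> \<le> koranyi_dist p' q} then 1 / (koranyi_dist p' q)\<^sup>2 * hspeed (T \<circ> \<gamma>) s else 0)
          = a * (speed_kernel \<gamma> p s * indicator {s \<in> {0<..<1}. h s \<ge> a * \<epsilon>} s)"
      proof (cases "s \<in> {0<..<1}")
        case True
        obtain e Z w B where "null_chart \<gamma> s e Z w B" using knot_null_chart[OF K] by blast
        then interpret null_chart \<gamma> s e Z w B .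
        obtain q where q: "\<gamma> s = Some q" using s True by (cases "\<gamma> s") (auto simp: X_def)
        obtain q' where q': "T (\<gamma> s) = Some q'" using s True by (cases "T (\<gamma> s)") (auto simp: X_def)
        have "fst (A (v s)) \<noteq> 0" by (rule dist_eq(2)[OF A p' center q'])
        moreover have "fst (v s) \<noteq> 0" by (rule herm_base(1)[OF q])
        ultimately have "speed_kernel (T \<circ> \<gamma>) p' s = a * speed_kernel \<gamma> p s"
          unfolding speed_kernel_image_eq[OF A p' center] speed_kernel_eq[OF center] by (simp add: a_def)
        then have "hspeed (T \<circ> \<gamma>) s / (koranyi_dist p' q')\<^sup>2 = a * speed_kernel \<gamma> p s"
          by (simp add: speed_kernel_def[of "T \<circ> \<gamma>"] q')
        moreover have "h s \<ge> a * \<epsilon> \<longleftrightarrow> koranyi_dist p' q' \<ge> \<epsilon>"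
          using a by (simp add: h_def scaled_dist_def q')
        ultimately show ?thesis using True q' by (auto simp: indicator_def)
      next
        case False
        then show ?thesis using s by (auto simp: indicator_def)
      qed
    qed auto
    then show ?thesis by simp
  qed
  \<comment> \<open>Truncating the image at \<epsilon> means truncating \<open>h\<close> at
    \<open>a * \<epsilon>\<close>; after multiplication by \<open>a\<close> the counterterm
    \<open>2 / (a * \<epsilon>)\<close> becomes exactly \<open>2 / \<epsilon>\<close>.\<close>
  have "filterlim (\<lambda>\<epsilon>. a * \<epsilon>) (at_right 0) (at_right 0)"
    using a eventually_at_right_less[of "0::real"]
    by (auto simp: filterlim_at elim!: eventually_mono intro!: tendsto_eq_intros)
  from tendsto_mult[OF tendsto_const[of a] filterlim_compose[OF lim this]]
  have "((\<lambda>\<epsilon>. a * ((\<integral>s. speed_kernel \<gamma> p s * indicator {s \<in> {0<..<1}. h s \<ge> a * \<epsilon>} s \<partial>lborel) - 2 / (a * \<epsilon>)))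
      \<longlongrightarrow> a * renormalized_potential \<gamma> p t) (at_right 0)" .
  then have "((\<lambda>\<epsilon>. arc_integral (T \<circ> \<gamma>) {q. koranyi_dist p' q \<ge> \<epsilon>} (\<lambda>q. 1 / (koranyi_dist p' q)\<^sup>2) - 2 / \<epsilon>)
      \<longlongrightarrow> a * renormalized_potential \<gamma> p t) (at_right 0)"
    unfolding arc using a by (simp add: right_diff_distrib)
  \<comment> \<open>\<open>Lim\<close> is a choice operator, so its value is known only because
    convergence has been proved.\<close>
  then show ?thesis unfolding Vpot_def a_def by (intro tendsto_Lim) auto
qed

theorem theorem4p1:
  assumes "legendrian_knot \<gamma>"
    and "T \<in> mobius"
  shows "energy (T \<circ> \<gamma>) = energy \<gamma>"
proof -
  note K = assms(1)
  obtain A where A: "lin_lift A T" using mobius_lin_lift[OF assms(2)] by blast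
  define X where "X = {s \<in> {0..<1}. \<gamma> s = None} \<union> {s \<in> {0..<1}. T (\<gamma> s) = None}"
  have X: "finite X"
    unfolding X_def using knot_finite_infinities[OF K lin_lift_inj[OF lin_lift_id]]
      knot_finite_infinities[OF K lin_lift_inj[OF A]] by simp
  show ?thesis
    unfolding energy_def arc_integral_def set_lebesgue_integral_def
  \<comment> \<open>The parameter 0 is discarded together with the points at infinity, so that every
    base point is interior to the unit interval.\<close>
  proof (rule integral_discrete_difference[where X = "X \<union> {0}"])
    show "countable (X \<union> {0})" using X by (simp add: countable_finite)
    fix t assume t: "t \<notin> X \<union> {0}"
    show "indicator {0..<1} t *\<^sub>R (case (T \<circ> \<gamma>) t of None \<Rightarrow> 0
          | Some q \<Rightarrow> if q \<in> UNIV then Vpot (T \<circ> \<gamma>) q * hspeed (T \<circ> \<gamma>) t else 0)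
        = indicator {0..<1} t *\<^sub>R (case \<gamma> t of None \<Rightarrow> 0
          | Some q \<Rightarrow> if q \<in> UNIV then Vpot \<gamma> q * hspeed \<gamma> t else 0)"
    proof (cases "t \<in> {0..<1}")
      case True
      then have t01: "0 < t" "t < 1" using t by auto
      obtain p where p: "\<gamma> t = Some p" using t True by (cases "\<gamma> t") (auto simp: X_def)
      obtain p' where p': "T (Some p) = Some p'" using t True p by (cases "T (Some p)") (auto simp: X_def)
      obtain e Z w B where "null_chart \<gamma> t e Z w B" using knot_null_chart[OF K] by blast
      then interpret null_chart \<gamma> t e Z w B .
      have "Vpot \<gamma> p = renormalized_potential \<gamma> p t"
        using Vpot_mobius[OF K t01 p lin_lift_id, of p] by simp
      \<comment> \<open>The potential gains the factor \<open>conf_factor A p\<close> and the speed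
        loses it, so the products agree.\<close>
      moreover note Vpot_mobius[OF K t01 p A p'] hspeed_base(2)[OF p A p'] lin_lift_Some(3)[OF A p']
      ultimately show ?thesis by (simp add: p p')
    qed simp
  qed auto
qed

end
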